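(* For all $\varepsilon>0$ and all $0\le\beta\le\beta_c$, $$\limsup_{N\to\infty}\frac1N\log T_{av}(\varepsilon)\le\beta^2,$$ where $T_{av}(\varepsilon)$ is the averaged equilibration time, defined in the context, of the process of the environment seen from the Metropolis dynamics of the Random Energy Model.
   Context: Let $S_N=\{-1,+1\}^N$ with the group operation $(\sigma.\sigma')_i=\sigma_i\sigma'_i$. Let $\underline i\in S_N$ be the configuration with $i$-th coordinate $-1$ and all others $+1$. Let $\Omega=\mathbb R^{S_N}$ and let $\mathcal Q$ be the centered product Gaussian probability on $\Omega$ with each coordinate of variance $N$. $S_N$ acts on $\Omega$ by $(\sigma.h)(\sigma')=h(\sigma.\sigma')$. $\beta_c=\sqrt{2\log2}$. For $H\in\Omega$ and $\beta\ge0$, let $X^H$ be the continuous-time Markov process on $S_N$ with generator $$L^Hf(\sigma)=\frac1N\sum_{i=1}^Ne^{-\beta[H(\underline i.\sigma)-H(\sigma)]^+}\big(f(\underline i.\sigma)-f(\sigma)\big),$$ where $[x]^+=\max\{x,0\}$. The process of the environment seen from the particle is $\omega_t=X^H_t.H\in\Omega$; $e^H_\sigma$ denotes the law (and expectation) of $(\omega_t)_{t\ge0}$ when $X^H_0=\sigma$. Let $\pi^H_\beta(\sigma)=e^{-\beta H(\sigma)}/\sum_{\sigma'}e^{-\beta H(\sigma')}$ and, for bounded measurable $\varphi:\Omega\to\mathbb R$, $\nu^H_\beta(\varphi)=\sum_{\sigma\in S_N}\varphi(\sigma.H)\pi^H_\beta(\sigma)$. Define $$T_{av}(\varepsilon)=\inf\Big\{t>0:\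 \sup_{s\ge t}\ \sup_{\varphi:\|\varphi\|_\infty\le1}\mathcal Q\Big[\big|e^H_\sigma(\varphi(\omega_s))-\nu^H_\beta(\varphi)\big|\Big]\le\varepsilon\Big\},$$ where $\mathcal Q[\cdot]$ is expectation over $H$, $\varphi$ ranges over measurable functions on $\Omega$, and $\sigma\in S_N$ is any fixed starting configuration (the quantity does not depend on the choice of $\sigma$). *)

theory Defs
  imports "HOL-Probability.Probability"
begin

text \<open>
  Sites are \<open>1, ..., N\<close>.  Configurations, and functions on the set of configurations, are
  represented by extensional functions (with value \<open>undefined\<close> off their domain), because
  \<open>N\<close> varies inside the statement.
\<close>

type_synonym config = "nat \<Rightarrow> int"
type_synonym env = "config \<Rightarrow> real"

definition configs :: "nat \<Rightarrow> config set" where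
  "configs N = {1..N} \<rightarrow>\<^sub>E {-1, 1}"

definition cmult :: "nat \<Rightarrow> config \<Rightarrow> config \<Rightarrow> config" where
  "cmult N \<sigma> \<sigma>' = (\<lambda>i\<in>{1..N}. \<sigma> i * \<sigma>' i)"

definition cflip :: "nat \<Rightarrow> nat \<Rightarrow> config" where
  "cflip N i = (\<lambda>j\<in>{1..N}. if j = i then -1 else 1)"

definition env_act :: "nat \<Rightarrow> config \<Rightarrow> env \<Rightarrow> env" where
  "env_act N \<sigma> h = (\<lambda>\<sigma>'\<in>configs N. h (cmult N \<sigma> \<sigma>'))"

definition env_space :: "nat \<Rightarrow> env measure" where
  "env_space N = (\<Pi>\<^sub>M \<sigma>\<in>configs N. borel)"

text \<open>The second argument of \<^const>\<open>normal_density\<close> is the standard deviation, so the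
  variance is \<open>N\<close>.\<close>

definition rem_measure :: "nat \<Rightarrow> env measure" where
  "rem_measure N =
     (\<Pi>\<^sub>M \<sigma>\<in>configs N. density lborel (\<lambda>x. ennreal (normal_density 0 (sqrt (real N)) x)))"

definition metropolis_generator ::
    "nat \<Rightarrow> real \<Rightarrow> env \<Rightarrow> (config \<Rightarrow> real) \<Rightarrow> config \<Rightarrow> real" where
  "metropolis_generator N \<beta> H f \<sigma> =
     1 / real N * (\<Sum>i=1..N. exp (- \<beta> * max (H (cmult N (cflip N i) \<sigma>) - H \<sigma>) 0)
                             * (f (cmult N (cflip N i) \<sigma>) - f \<sigma>))"

definition markov_semigroup :: "'s set \<Rightarrow> (real \<Rightarrow> 's \<Rightarrow> 's \<Rightarrow> real) \<Rightarrow> bool" where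
  "markov_semigroup S P \<longleftrightarrow>
     (\<forall>t\<ge>0. \<forall>x\<in>S. \<forall>y\<in>S. P t x y \<ge> 0) \<and>
     (\<forall>t\<ge>0. \<forall>x\<in>S. (\<Sum>y\<in>S. P t x y) = 1) \<and>
     (\<forall>x\<in>S. \<forall>y\<in>S. P 0 x y = (if x = y then 1 else 0)) \<and>
     (\<forall>s\<ge>0. \<forall>t\<ge>0. \<forall>x\<in>S. \<forall>z\<in>S. P (s + t) x z = (\<Sum>y\<in>S. P s x y * P t y z))"

definition semigroup_has_generator ::
    "'s set \<Rightarrow> (real \<Rightarrow> 's \<Rightarrow> 's \<Rightarrow> real) \<Rightarrow> (('s \<Rightarrow> real) \<Rightarrow> 's \<Rightarrow> real) \<Rightarrow> bool" where
  "semigroup_has_generator S P L \<longleftrightarrow>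
     (\<forall>f. \<forall>x\<in>S. ((\<lambda>t. ((\<Sum>y\<in>S. P t x y * f y) - f x) / t) \<longlongrightarrow> L f x) (at_right 0))"

text \<open>
  \<open>X\<close>, defined on the probability space \<open>M\<close>, is a continuous-time Markov process on the finite set
  \<open>S\<close> with generator \<open>L\<close> and initial state \<open>x0\<close>.  The Markov property is expressed through
  the finite-dimensional distributions along times \<open>0 = t 0 \<le> t 1 \<le> ... \<le> t n\<close>.  No
  regularity of the sample paths is imposed.
\<close>

definition markov_process ::
    "'w measure \<Rightarrow> (real \<Rightarrow> 'w \<Rightarrow> 's) \<Rightarrow> 's set \<Rightarrow> (('s \<Rightarrow> real) \<Rightarrow> 's \<Rightarrow> real) \<Rightarrow> 's \<Rightarrow> bool" where
  "markov_process M X S L x0 \<longleftrightarrow>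
     prob_space M \<and>
     (\<forall>t\<ge>0. X t \<in> measurable M (count_space S)) \<and>
     (\<exists>P. markov_semigroup S P \<and> semigroup_has_generator S P L \<and>
       (\<forall>(n::nat) (t::nat \<Rightarrow> real) (x::nat \<Rightarrow> 's).
          t 0 = 0 \<longrightarrow> (\<forall>k<n. t k \<le> t (Suc k)) \<longrightarrow> (\<forall>k\<le>n. x k \<in> S) \<longrightarrow>
          measure M {w \<in> space M. \<forall>k\<le>n. X (t k) w = x k} =
            (if x 0 = x0 then 1 else 0) * (\<Prod>k<n. P (t (Suc k) - t k) (x k) (x (Suc k)))))"

definition metropolis_process ::
    "nat \<Rightarrow> real \<Rightarrow> env \<Rightarrow> config \<Rightarrow> 'w measure \<Rightarrow> (real \<Rightarrow> 'w \<Rightarrow> config) \<Rightarrow> bool" where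
  "metropolis_process N \<beta> H \<sigma> M X \<longleftrightarrow>
     markov_process M X (configs N) (metropolis_generator N \<beta> H) \<sigma>"

definition env_process ::
    "nat \<Rightarrow> env \<Rightarrow> (real \<Rightarrow> 'w \<Rightarrow> config) \<Rightarrow> real \<Rightarrow> 'w \<Rightarrow> env" where
  "env_process N H X t w = env_act N (X t w) H"

definition gibbs :: "nat \<Rightarrow> real \<Rightarrow> env \<Rightarrow> config \<Rightarrow> real" where
  "gibbs N \<beta> H \<sigma> = exp (- \<beta> * H \<sigma>) / (\<Sum>\<sigma>'\<in>configs N. exp (- \<beta> * H \<sigma>'))"

definition env_equilibrium :: "nat \<Rightarrow> real \<Rightarrow> env \<Rightarrow> (env \<Rightarrow> real) \<Rightarrow> real" where
  "env_equilibrium N \<beta> H \<phi> = (\<Sum>\<sigma>\<in>configs N. \<phi> (env_act N \<sigma> H) * gibbs N \<beta> H \<sigma>)"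

definition test_functions :: "nat \<Rightarrow> (env \<Rightarrow> real) set" where
  "test_functions N =
     {\<phi> \<in> borel_measurable (env_space N). \<forall>\<omega>\<in>space (env_space N). \<bar>\<phi> \<omega>\<bar> \<le> 1}"

text \<open>
  The averaged equilibration time when, in environment \<open>H\<close>, the dynamics is realised by the
  process \<open>X H\<close> on the probability space \<open>M H\<close>; the starting configuration is that of \<open>X H\<close>.
  The infimum is taken in \<^typ>\<open>ereal\<close>, so that it is \<open>\<infinity>\<close> if there is no such \<open>t\<close>.
\<close>

definition T_av ::
    "nat \<Rightarrow> real \<Rightarrow> (env \<Rightarrow> 'w measure) \<Rightarrow> (env \<Rightarrow> real \<Rightarrow> 'w \<Rightarrow> config) \<Rightarrow> real \<Rightarrow> ereal" where
  "T_av N \<beta> M X \<epsilon> =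
     Inf {ereal t | t. t > 0 \<and>
       (SUP s\<in>{t..}. SUP \<phi>\<in>test_functions N.
          \<integral>\<^sup>+H. ennreal \<bar>(\<integral>w. \<phi> (env_process N H (X H) s w) \<partial>M H) - env_equilibrium N \<beta> H \<phi>\<bar>
            \<partial>rem_measure N)
        \<le> ennreal \<epsilon>}"

text \<open>Logarithm on \<open>[0, \<infinity>]\<close>, with \<open>log 0 = -\<infinity>\<close> (unlike \<open>ln 0 = 0\<close>) and \<open>log \<infinity> = \<infinity>\<close>.\<close>

definition elog :: "ereal \<Rightarrow> ereal" where
  "elog x = (if x \<le> 0 then -\<infinity> else if x = \<infinity> then \<infinity> else ereal (ln (real_of_ereal x)))"

definition beta_c :: real where
  "beta_c = sqrt (2 * ln 2)"

end

theory Submission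
  imports Defs "HOL-Real_Asymp.Real_Asymp"
begin

text \<open>
  Let \<open>u\<^sub>t(x) = E\<^sub>x \<phi>(X\<^sub>t.H)\<close>.  By invariance of the Gaussian measure under the group action, starting at a
  fixed site amounts to starting uniformly on the hypercube.  Reversibility bounds the Dirichlet form
  of \<open>u\<^sub>t\<close> (with unnormalised weights) by \<open>Z / t\<close>.  Sites with energy above \<open>\<delta> N\<close> are so sparse
  that bounded detours avoid them, and along low sites all conductances are at least
  \<open>exp (- \<beta> \<delta> N) / N\<close>; so the Poincare inequality of the hypercube makes \<open>u\<^sub>t\<close> close to one constant
  \<open>m\<close> in mean square.  The constant is the Gibbs mean up to a small error: a site of energy at least
  \<open>- (\<beta> + \<delta>) N\<close> has weight at most \<open>exp (\<beta> (\<beta> + \<delta>) N)\<close> and can be compared with a low neighbour,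
  and the deeper sites carry little Gibbs mass when \<open>\<beta> \<le> \<beta>\<^sub>c\<close>.  The mean square errors that depend on \<open>t\<close>
  are at most \<open>exp ((\<beta>\<^sup>2 + 2 \<beta> \<delta>) N) / t\<close> up to a polynomial in \<open>N\<close>.
\<close>

section \<open>Evolution equations on a finite state space\<close>

text \<open>A bound valid for every starting site would have to wait for the escape from the deepest
  sites, of energy near \<open>- beta_c * N\<close>, and would give the exponent \<beta> times
  \<open>beta_c\<close>. What makes \<beta>^2 possible is that the conductance of an edge depends
  only on its higher endpoint. Hence deep sites do not hinder the uniform mean square; they enter
  only through the Gibbs mean and through Z. When \<beta> is at most \<open>beta_c\<close>, both are
  dominated by energies near \<open>- \<beta> * N\<close>, the mean of the Gaussian tilted by the
  Boltzmann weight. No spectral gap is needed: decay of order 1 / t of the Dirichlet form is enough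
  on the exponential scale. The factor exp (\<beta> d), for d = (\<beta> + \<delta>) N, arises
  twice: as the largest weight of a site that is not deep, and, times 2^N, as a bound for Z.\<close>

definition evolves :: "'s set \<Rightarrow> (('s \<Rightarrow> real) \<Rightarrow> 's \<Rightarrow> real) \<Rightarrow> (real \<Rightarrow> 's \<Rightarrow> real) \<Rightarrow> bool" where
  "evolves S L v \<longleftrightarrow>
     (\<forall>t\<ge>0. \<forall>x\<in>S. ((\<lambda>t. v t x) has_real_derivative L (v t) x) (at t within {0..}))"

lemma evolvesD:
  "evolves S L v \<Longrightarrow> 0 \<le> t \<Longrightarrow> x \<in> S \<Longrightarrow>
     ((\<lambda>t. v t x) has_real_derivative L (v t) x) (at t within {0..})"
  by (simp add: evolves_def)

text \<open>\<open>semigroup_has_generator\<close> speaks only of the right derivative at time 0,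
  which the semigroup law moves to a right derivative at every \<open>t\<close>. The left derivative
  takes more: \<open>A (t - h)\<close> applied to \<open>(A h f - f) / h\<close> converges because
  the entries of \<open>P\<close> are left continuous in time (\<open>P_left\<close>), and its limit
  \<open>A t (L f)\<close> must be recognised as \<open>L (A t f)\<close>
  (\<open>commute\<close>).\<close>

lemma semigroup_evolves:
  fixes f :: "'s \<Rightarrow> real"
  assumes fin: "finite S" and P: "markov_semigroup S P" and gen: "semigroup_has_generator S P L"
  shows "evolves S L (\<lambda>t x. \<Sum>y\<in>S. P t x y * f y)"
  unfolding evolves_def
proof (intro allI impI ballI)
  define A where "A = (\<lambda>t g x. \<Sum>y\<in>S. P t x y * g y)"
  have A_add: "A (s + t) g x = A s (A t g) x" if "0 \<le> s" "0 \<le> t" "x \<in> S" for s t x g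
  proof -
    have "A (s + t) g x = (\<Sum>z\<in>S. \<Sum>y\<in>S. P s x y * P t y z * g z)"
      using P that unfolding A_def markov_semigroup_def by (simp add: sum_distrib_right)
    also have "\<dots> = A s (A t g) x"
      unfolding A_def by (subst sum.swap) (simp add: sum_distrib_left mult.assoc)
    finally show ?thesis .
  qed
  have A_gen: "((\<lambda>h. (A h g x - g x) / h) \<longlongrightarrow> L g x) (at_right 0)" if "x \<in> S" for g x
    using gen that unfolding semigroup_has_generator_def A_def by blast
  have P_nonneg: "0 \<le> P t x y" if "0 \<le> t" "x \<in> S" "y \<in> S" for t x y
    using P that unfolding markov_semigroup_def by blast
  have P_sum: "(\<Sum>y\<in>S. P t x y) = 1" if "0 \<le> t" "x \<in> S" for t x
    using P that unfolding markov_semigroup_def by blast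
  have P_le_1: "P t x y \<le> 1" if "0 \<le> t" "x \<in> S" "y \<in> S" for t x y
    using member_le_sum[of y S "P t x"] P_sum[of t x] P_nonneg that fin by force
  have A_cont0: "((\<lambda>h. A h g x - g x) \<longlongrightarrow> 0) (at_right 0)" if "x \<in> S" for g x
  proof -
    have "((\<lambda>h. (A h g x - g x) / h * h) \<longlongrightarrow> L g x * 0) (at_right 0)"
      by (intro tendsto_mult A_gen that tendsto_ident_at)
    moreover have "\<forall>\<^sub>F h in at_right 0. (A h g x - g x) / h * h = A h g x - g x"
      by (auto simp: eventually_at_filter)
    ultimately show ?thesis
      by (simp add: filterlim_cong)
  qed
  have A_tendsto: "((\<lambda>h. A t (B h) x) \<longlongrightarrow> A t b x) F"
    if "\<And>y. y \<in> S \<Longrightarrow> ((\<lambda>h. B h y) \<longlongrightarrow> b y) F" for t x b and B :: "real \<Rightarrow> 's \<Rightarrow> real" and F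
    unfolding A_def by (intro tendsto_sum tendsto_mult tendsto_const that)
  have A_diff: "A t (\<lambda>y. (a y - b y) / h) x = (A t a x - A t b x) / h" for t x a b and h :: real
    unfolding A_def by (simp add: algebra_simps sum_subtractf sum_divide_distrib diff_divide_distrib)
  \<comment> \<open>Both sides are right limits of the same quotient, since \<open>A t\<close> and
    \<open>A h\<close> commute.\<close>
  have commute: "A t (L g) x = L (A t g) x" if "0 \<le> t" "x \<in> S" for t x g
  proof -
    have "((\<lambda>h. A t (\<lambda>y. (A h g y - g y) / h) x) \<longlongrightarrow> A t (L g) x) (at_right 0)"
      by (intro A_tendsto A_gen)
    moreover have "((\<lambda>h. (A h (A t g) x - A t g x) / h) \<longlongrightarrow> L (A t g) x) (at_right 0)"
      by (intro A_gen that)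
    moreover have "\<forall>\<^sub>F h in at_right 0.
        A t (\<lambda>y. (A h g y - g y) / h) x = (A h (A t g) x - A t g x) / h"
    proof (rule eventually_at_rightI[of 0 1])
      fix h :: real assume "h \<in> {0<..<1}"
      then show "A t (\<lambda>y. (A h g y - g y) / h) x = (A h (A t g) x - A t g x) / h"
        using A_add[of t h x g] A_add[of h t x g] that by (simp add: A_diff add.commute)
    qed simp
    ultimately show ?thesis
      using tendsto_unique[of "at_right (0::real)"] by (auto simp: filterlim_cong)
  qed
  fix t :: real and x assume t: "0 \<le> t" and x: "x \<in> S"
  have right: "((\<lambda>h. (A (t + h) f x - A t f x) / h) \<longlongrightarrow> L (A t f) x) (at_right 0)"
  proof (rule Lim_transform_eventually)
    show "((\<lambda>h. (A h (A t f) x - A t f x) / h) \<longlongrightarrow> L (A t f) x) (at_right 0)"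
      by (intro A_gen x)
    show "\<forall>\<^sub>F h in at_right 0. (A h (A t f) x - A t f x) / h = (A (t + h) f x - A t f x) / h"
      by (rule eventually_at_rightI[of 0 1]) (use A_add[of _ t x f] t x in \<open>auto simp: add.commute\<close>)
  qed
  show "((\<lambda>t. \<Sum>y\<in>S. P t x y * f y) has_real_derivative L (\<lambda>x. \<Sum>y\<in>S. P t x y * f y) x)
          (at t within {0..})"
  proof (cases "t = 0")
    case True
    have "((\<lambda>s. A s f x) has_real_derivative L (A 0 f) x) (at_right 0)"
      using right True by (simp add: has_field_derivative_iff)
    then show ?thesis
      unfolding True A_def at_within_Ici_at_right .
  next
    case False
    with t have t: "0 < t" by simp
    \<comment> \<open>Left continuity at \<open>t\<close> comes from right continuity at 0: the
      difference of the entries is \<open>P (t - h)\<close> applied to \<open>A h e - e\<close>,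
      where \<open>e\<close> is the indicator of \<open>y\<close>, and the entries of
      \<open>P (t - h)\<close> lie between 0 and 1.\<close>
    have P_left: "((\<lambda>h. P (t - h) x y) \<longlongrightarrow> P t x y) (at_right 0)" if "y \<in> S" for y
    proof -
      have 1: "((\<lambda>h. \<Sum>z\<in>S. \<bar>A h (\<lambda>u. if u = y then 1 else 0) z - (if z = y then 1 else 0)\<bar>) \<longlongrightarrow> 0)
            (at_right 0)"
        by (intro tendsto_null_sum tendsto_rabs_zero A_cont0)
      have "((\<lambda>h. P (t - h) x y - P t x y) \<longlongrightarrow> 0) (at_right 0)"
      proof (rule Lim_null_comparison[OF _ 1])
        show "\<forall>\<^sub>F h in at_right 0. norm (P (t - h) x y - P t x y)
           \<le> (\<Sum>z\<in>S. \<bar>A h (\<lambda>u. if u = y then 1 else 0) z - (if z = y then 1 else 0)\<bar>)"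
        proof (rule eventually_at_rightI[OF _ t])
          fix h assume h: "h \<in> {0<..<t}"
          define e where "e = (\<lambda>u. if u = y then 1 else 0 :: real)"
          have e: "A s e z = P s z y" for s z
            using fin that by (simp add: A_def e_def if_distrib sum.delta cong: if_cong)
          have "P t x y = A (t - h) (A h e) x"
            using A_add[of "t - h" h x e] h x by (simp add: e)
          then have "P t x y - P (t - h) x y = (\<Sum>z\<in>S. P (t - h) x z * (A h e z - e z))"
            using e[of "t - h" x] by (simp add: A_def algebra_simps sum_subtractf)
          also have "\<bar>\<dots>\<bar> \<le> (\<Sum>z\<in>S. \<bar>A h e z - e z\<bar>)"
            by (rule order_trans[OF sum_abs sum_mono])
               (use P_nonneg[of "t - h" x] P_le_1[of "t - h" x] h x in \<open>auto simp: abs_mult intro!: mult_left_le_one_le\<close>)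
          finally show "norm (P (t - h) x y - P t x y)
             \<le> (\<Sum>z\<in>S. \<bar>A h (\<lambda>u. if u = y then 1 else 0) z - (if z = y then 1 else 0)\<bar>)"
            by (simp add: e_def)
        qed
      qed
      then show ?thesis
        using Lim_null by blast
    qed
    have left: "((\<lambda>h. (A (t - h) f x - A t f x) / (- h)) \<longlongrightarrow> L (A t f) x) (at_right 0)"
    proof (rule Lim_transform_eventually)
      show "((\<lambda>h. \<Sum>y\<in>S. P (t - h) x y * ((A h f y - f y) / h)) \<longlongrightarrow> L (A t f) x) (at_right 0)"
        unfolding commute[symmetric, OF less_imp_le[OF t] x] unfolding A_def[THEN fun_cong, THEN fun_cong, THEN fun_cong, of t "L f"]
        by (intro tendsto_sum tendsto_mult P_left A_gen)
      show "\<forall>\<^sub>F h in at_right 0. (\<Sum>y\<in>S. P (t - h) x y * ((A h f y - f y) / h))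
          = (A (t - h) f x - A t f x) / (- h)"
      proof (rule eventually_at_rightI[OF _ t])
        fix h assume h: "h \<in> {0<..<t}"
        have "(\<Sum>y\<in>S. P (t - h) x y * ((A h f y - f y) / h)) = A (t - h) (\<lambda>y. (A h f y - f y) / h) x"
          by (simp add: A_def)
        also have "\<dots> = (A t f x - A (t - h) f x) / h"
          using A_add[of "t - h" h x f] h x by (simp add: A_diff)
        finally show "(\<Sum>y\<in>S. P (t - h) x y * ((A h f y - f y) / h)) = (A (t - h) f x - A t f x) / (- h)"
          using h by (simp add: field_simps)
      qed
    qed
    have "((\<lambda>h. (A (t + h) f x - A t f x) / h) \<longlongrightarrow> L (A t f) x) (at 0)"
    proof (rule filterlim_split_at[OF _ right])
      show "((\<lambda>h. (A (t + h) f x - A t f x) / h) \<longlongrightarrow> L (A t f) x) (at_left 0)"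
        using left by (subst filterlim_at_left_to_right) simp
    qed
    then have "((\<lambda>t. A t f x) has_real_derivative L (A t f) x) (at t)"
      by (simp add: DERIV_def)
    then show ?thesis
      unfolding A_def by (rule has_field_derivative_at_within)
  qed
qed

section \<open>Energy dissipation for reversible flip dynamics\<close>

locale reversible_flips =
  fixes S :: "'s set" and I :: "'i set" and F :: "'i \<Rightarrow> 's \<Rightarrow> 's"
    and w :: "'s \<Rightarrow> real" and r :: "'s \<Rightarrow> 'i \<Rightarrow> real"
  assumes finite_S: "finite S" and finite_I: "finite I"
    and F_in: "\<And>i x. i \<in> I \<Longrightarrow> x \<in> S \<Longrightarrow> F i x \<in> S"
    and F_F: "\<And>i x. i \<in> I \<Longrightarrow> x \<in> S \<Longrightarrow> F i (F i x) = x"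
    and w_pos: "\<And>x. x \<in> S \<Longrightarrow> 0 < w x"
    and r_nonneg: "\<And>i x. i \<in> I \<Longrightarrow> x \<in> S \<Longrightarrow> 0 \<le> r x i"
    and balance: "\<And>i x. i \<in> I \<Longrightarrow> x \<in> S \<Longrightarrow> w (F i x) * r (F i x) i = w x * r x i"
begin

definition gen :: "('s \<Rightarrow> real) \<Rightarrow> 's \<Rightarrow> real" where
  "gen f x = (\<Sum>i\<in>I. r x i * (f (F i x) - f x))"

text \<open>Every edge is counted from both endpoints, so this is twice the usual Dirichlet form.
  With this normalisation the weighted sum of squares of a solution decreases exactly at rate
  \<open>dirichlet\<close>.\<close>

definition dirichlet :: "('s \<Rightarrow> real) \<Rightarrow> real" where
  "dirichlet f = (\<Sum>x\<in>S. \<Sum>i\<in>I. w x * r x i * (f (F i x) - f x)\<^sup>2)"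

lemma sum_flip: "i \<in> I \<Longrightarrow> (\<Sum>x\<in>S. g (F i x)) = (\<Sum>x\<in>S. g x)"
  by (rule sum.reindex_bij_witness[of _ "F i" "F i"]) (auto simp: F_in F_F)

text \<open>For a fixed flip the current \<open>a x i\<close> changes sign under \<open>F i\<close>,
  by detailed balance. As \<open>F i\<close> is an involution of \<open>S\<close>, substituting
  \<open>F i x\<close> for \<open>x\<close> is then a summation by parts.\<close>

lemma green:
  "(\<Sum>x\<in>S. \<Sum>i\<in>I. w x * r x i * (f (F i x) - f x) * (g (F i x) - g x)) =
     - 2 * (\<Sum>x\<in>S. w x * f x * gen g x)"
proof -
  define a where "a x i = w x * r x i * (g (F i x) - g x)" for x i
  have a: "a (F i x) i = - a x i" if "i \<in> I" "x \<in> S" for i x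
    using balance[OF that] that by (simp add: a_def F_F algebra_simps)
  have "(\<Sum>x\<in>S. a x i * (f (F i x) - f x)) = - 2 * (\<Sum>x\<in>S. f x * a x i)" if i: "i \<in> I" for i
  proof -
    have "(\<Sum>x\<in>S. a x i * f (F i x)) = - (\<Sum>x\<in>S. a (F i x) i * f (F i x))"
      using i by (simp add: a sum_negf)
    also have "\<dots> = - (\<Sum>x\<in>S. a x i * f x)"
      using sum_flip[OF i, of "\<lambda>x. a x i * f x"] by simp
    finally show ?thesis
      by (simp add: right_diff_distrib sum_subtractf mult.commute)
  qed
  then have "(\<Sum>i\<in>I. \<Sum>x\<in>S. a x i * (f (F i x) - f x)) = - 2 * (\<Sum>i\<in>I. \<Sum>x\<in>S. f x * a x i)"
    by (simp add: sum_distrib_left)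
  moreover have "(\<Sum>x\<in>S. \<Sum>i\<in>I. w x * r x i * (f (F i x) - f x) * (g (F i x) - g x)) =
       (\<Sum>i\<in>I. \<Sum>x\<in>S. a x i * (f (F i x) - f x))"
    by (subst sum.swap) (simp add: a_def mult_ac)
  moreover have "(\<Sum>x\<in>S. w x * f x * gen g x) = (\<Sum>i\<in>I. \<Sum>x\<in>S. f x * a x i)"
    by (subst sum.swap) (simp add: a_def gen_def mult_ac sum_distrib_left)
  ultimately show ?thesis by simp
qed

lemma dirichlet_nonneg: "0 \<le> dirichlet f"
  unfolding dirichlet_def
  by (intro sum_nonneg mult_nonneg_nonneg less_imp_le[OF w_pos] r_nonneg zero_le_power2)

text \<open>Green's formula against the constant 1. This is how the equilibrium value enters
  \<open>metropolis_relaxation\<close>: it remains the weighted mean of the solution at all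
  times.\<close>

lemma evolves_sum_const:
  assumes v: "evolves S gen v" and t: "0 \<le> t"
  shows "(\<Sum>x\<in>S. w x * v t x) = (\<Sum>x\<in>S. w x * v 0 x)"
proof -
  have d: "((\<lambda>t. \<Sum>x\<in>S. w x * v t x) has_real_derivative 0) (at s within {0..})" if "0 \<le> s" for s
  proof -
    have "((\<lambda>t. \<Sum>x\<in>S. w x * v t x) has_real_derivative (\<Sum>x\<in>S. w x * gen (v s) x))
        (at s within {0..})"
      by (rule derivative_eq_intros evolvesD[OF v that] | assumption | simp)+
         (simp add: mult.commute)
    moreover have "(\<Sum>x\<in>S. w x * gen (v s) x) = 0"
      using green[of "\<lambda>_. 1" "v s"] by simp
    ultimately show ?thesis by simp
  qed
  have "\<exists>c. \<forall>s\<in>{0..}. (\<Sum>x\<in>S. w x * v s x) = c"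
    by (rule has_field_derivative_zero_constant) (auto intro: d)
  then show ?thesis
    using t by auto
qed

text \<open>The left-hand side is nonincreasing in \<open>t\<close>: its derivative is
  \<open>-4 t \<Sum>\<^sub>x w x (gen (v t) x)\<^sup>2\<close>.\<close>

lemma evolves_energy:
  assumes v: "evolves S gen v" and t: "0 \<le> t"
  shows "(\<Sum>x\<in>S. w x * (v t x)\<^sup>2) + t * dirichlet (v t) \<le> (\<Sum>x\<in>S. w x * (v 0 x)\<^sup>2)"
proof -
  define \<Phi> where "\<Phi> t = (\<Sum>x\<in>S. w x * (v t x)\<^sup>2) + t * dirichlet (v t)" for t
  define D where "D s = - 4 * s * (\<Sum>x\<in>S. w x * gen (v s) x * gen (v s) x)" for s
  have d: "(\<Phi> has_real_derivative D s) (at s within {0..})" if s: "0 \<le> s" for s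
  proof -
    have 1: "((\<lambda>t. \<Sum>x\<in>S. w x * (v t x)\<^sup>2) has_real_derivative 2 * (\<Sum>x\<in>S. w x * v s x * gen (v s) x))
        (at s within {0..})"
      by (rule derivative_eq_intros evolvesD[OF v s] | assumption | simp)+
         (simp add: sum_distrib_left mult_ac)
    have 2: "((\<lambda>t. dirichlet (v t)) has_real_derivative
        2 * (\<Sum>x\<in>S. \<Sum>i\<in>I. w x * r x i * (gen (v s) (F i x) - gen (v s) x) * (v s (F i x) - v s x)))
        (at s within {0..})"
      unfolding dirichlet_def
      by (rule derivative_eq_intros evolvesD[OF v s] F_in | assumption | simp)+
         (simp add: sum_distrib_left mult_ac)
    have "(\<Phi> has_real_derivative 2 * (\<Sum>x\<in>S. w x * v s x * gen (v s) x) + (1 * dirichlet (v s)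
        + 2 * (\<Sum>x\<in>S. \<Sum>i\<in>I. w x * r x i * (gen (v s) (F i x) - gen (v s) x) * (v s (F i x) - v s x)) * s))
        (at s within {0..})"
      unfolding \<Phi>_def by (intro DERIV_add DERIV_mult 1 2 DERIV_ident)
    moreover have "dirichlet (v s) = - 2 * (\<Sum>x\<in>S. w x * v s x * gen (v s) x)"
      using green[of "v s" "v s"] by (simp add: dirichlet_def power2_eq_square mult.assoc)
    ultimately show ?thesis
      unfolding green D_def by (simp add: mult_ac)
  qed
  have "\<Phi> t \<le> \<Phi> 0"
  proof (rule DERIV_nonpos_imp_decreasing_open[OF t, where f = \<Phi>])
    show "\<exists>y. DERIV \<Phi> s :> y \<and> y \<le> 0" if "0 < s" "s < t" for s
    proof (intro exI conjI)
      have "at s within {0..} = at s"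
        using that by (intro at_within_open_subset[of s "{0<..}"]) auto
      then show "DERIV \<Phi> s :> D s"
        using d[of s] that by simp
      have "0 \<le> (\<Sum>x\<in>S. w x * gen (v s) x * gen (v s) x)"
        by (intro sum_nonneg) (simp add: mult.assoc w_pos less_imp_le)
      then show "D s \<le> 0"
        using that by (simp add: D_def)
    qed
    have "continuous_on {0..} \<Phi>"
      by (rule DERIV_continuous_on) (use d in auto)
    then show "continuous_on {0..t} \<Phi>"
      by (rule continuous_on_subset) auto
  qed
  then show ?thesis by (simp add: \<Phi>_def)
qed

lemma gen_diff: "gen (\<lambda>x. f x - g x) x = gen f x - gen g x"
  unfolding gen_def sum_subtractf[symmetric] by (rule sum.cong) (auto simp: algebra_simps)

text \<open>The difference solves the same linear equation from zero data. The energy inequality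
  keeps its weighted sum of squares at zero, and all weights are positive.\<close>

lemma evolves_unique:
  assumes u: "evolves S gen u" and v: "evolves S gen v"
    and init: "\<And>x. x \<in> S \<Longrightarrow> u 0 x = v 0 x" and t: "0 \<le> t" and x: "x \<in> S"
  shows "u t x = v t x"
proof -
  have "evolves S gen (\<lambda>t x. u t x - v t x)"
    using u v unfolding evolves_def gen_diff by (auto intro!: DERIV_diff)
  from evolves_energy[OF this t] have "(\<Sum>x\<in>S. w x * (u t x - v t x)\<^sup>2) \<le> 0"
    using t dirichlet_nonneg[of "\<lambda>x. u t x - v t x"] mult_nonneg_nonneg[of t]
    by (fastforce simp: init intro: order_trans[rotated])
  moreover have "0 \<le> w x * (u t x - v t x)\<^sup>2" if "x \<in> S" for x
    using w_pos[OF that] by simp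
  ultimately have "w x * (u t x - v t x)\<^sup>2 = 0"
    using sum_nonneg_eq_0_iff[OF finite_S, of "\<lambda>x. w x * (u t x - v t x)\<^sup>2"]
      sum_nonneg[of S "\<lambda>x. w x * (u t x - v t x)\<^sup>2"] x by (meson dual_order.antisym)
  then show ?thesis
    using w_pos[OF x] by simp
qed

end

section \<open>The hypercube\<close>

abbreviation flip :: "nat \<Rightarrow> nat \<Rightarrow> config \<Rightarrow> config" where
  "flip N i \<equiv> cmult N (cflip N i)"

lemma finite_configs [simp]: "finite (configs N)"
  by (simp add: configs_def finite_PiE)

lemma card_configs: "card (configs N) = 2 ^ N"
  by (simp add: configs_def card_PiE numeral_2_eq_2[symmetric])

lemma cmult_in_configs [simp]: "\<sigma> \<in> configs N \<Longrightarrow> \<tau> \<in> configs N \<Longrightarrow> cmult N \<sigma> \<tau> \<in> configs N"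
  by (fastforce simp: configs_def cmult_def PiE_iff)

lemma cflip_in_configs [simp]: "cflip N i \<in> configs N"
  by (auto simp: configs_def cflip_def)

lemma cmult_commute: "cmult N \<sigma> \<tau> = cmult N \<tau> \<sigma>"
  by (simp add: cmult_def mult.commute)

lemma cmult_left_commute: "cmult N \<sigma> (cmult N \<tau> \<rho>) = cmult N \<tau> (cmult N \<sigma> \<rho>)"
  by (auto simp: cmult_def mult_ac)

lemma cmult_assoc: "cmult N (cmult N \<sigma> \<tau>) \<rho> = cmult N \<sigma> (cmult N \<tau> \<rho>)"
  by (auto simp: cmult_def mult_ac)

lemma cmult_cancel [simp]:
  assumes "\<sigma> \<in> configs N" "\<tau> \<in> configs N" shows "cmult N \<sigma> (cmult N \<sigma> \<tau>) = \<tau>"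
proof
  fix i
  have "\<sigma> i * \<sigma> i = 1" if "i \<in> {1..N}"
  proof -
    have "\<sigma> i \<in> {-1, 1}"
      using assms(1) that unfolding configs_def by (rule PiE_mem)
    then show ?thesis by auto
  qed
  then show "cmult N \<sigma> (cmult N \<sigma> \<tau>) i = \<tau> i"
    using assms by (auto simp: cmult_def configs_def PiE_iff extensional_def mult.assoc[symmetric])
qed

lemma sum_cmult:
  "\<sigma> \<in> configs N \<Longrightarrow> (\<Sum>x\<in>configs N. g (cmult N \<sigma> x)) = (\<Sum>x\<in>configs N. g x)"
  by (rule sum.reindex_bij_witness[of _ "cmult N \<sigma>" "cmult N \<sigma>"]) auto

text \<open>Distinct flips lead to distinct sites, hence to independent energies; this is what
  \<open>measure_rem_many_high_neighbours\<close> counts on.\<close>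

lemma inj_on_flip:
  assumes "x \<in> configs N" shows "inj_on (\<lambda>i. flip N i x) {1..N}"
proof (rule inj_onI)
  fix i j assume ij: "i \<in> {1..N}" "j \<in> {1..N}" and eq: "flip N i x = flip N j x"
  have "cmult N x (flip N l x) = cflip N l" for l
    using assms by (subst (2) cmult_commute) simp
  then have "cflip N i = cflip N j"
    using eq by metis
  then have "cflip N i i = cflip N j i" by simp
  then show "i = j"
    using ij by (simp add: cflip_def split: if_splits)
qed

text \<open>Group elements are coded by the set of their coordinates -1, so that a translation can
  be built one flip at a time by induction over a finite set.\<close>

definition cminus :: "nat \<Rightarrow> nat set \<Rightarrow> config" where
  "cminus N A = (\<lambda>j\<in>{1..N}. if j \<in> A then -1 else 1)"

lemma cminus_in_configs [simp]: "cminus N A \<in> configs N"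
  by (auto simp: cminus_def configs_def)

lemma cminus_empty [simp]: "x \<in> configs N \<Longrightarrow> cmult N (cminus N {}) x = x"
  by (auto simp: cminus_def cmult_def configs_def PiE_iff extensional_def)

lemma cminus_insert: "i \<notin> A \<Longrightarrow> cminus N (insert i A) = flip N i (cminus N A)"
  by (auto simp: cminus_def cmult_def cflip_def)

lemma cminus_cases:
  assumes "\<tau> \<in> configs N" shows "\<exists>A\<subseteq>{1..N}. \<tau> = cminus N A"
proof (intro exI conjI)
  show "\<tau> = cminus N {i \<in> {1..N}. \<tau> i = -1}"
    using assms by (fastforce simp: cminus_def configs_def PiE_iff extensional_def)
qed auto

text \<open>The shift \<open>x \<mapsto> \<tau>.x\<close> is a composition of at most \<open>N\<close> flips, and each of them preserves the
  uniform measure, so the \<open>L\<^sup>2\<close> triangle inequality applies.\<close>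

lemma sum_shift_diff_le:
  assumes M: "\<And>i. i \<in> {1..N} \<Longrightarrow> (\<Sum>x\<in>configs N. (g (flip N i x) - g x)\<^sup>2) \<le> M" "0 \<le> M"
    and \<tau>: "\<tau> \<in> configs N"
  shows "(\<Sum>x\<in>configs N. (g (cmult N \<tau> x) - g x)\<^sup>2) \<le> (real N)\<^sup>2 * M"
proof -
  have *: "L2_set (\<lambda>x. g (cmult N (cminus N A) x) - g x) (configs N) \<le> card A * sqrt M"
    if "finite A" "A \<subseteq> {1..N}" for A
    using that
  proof (induction A)
    case empty
    then show ?case by (simp add: L2_set_def)
  next
    case (insert i A)
    let ?\<sigma> = "cmult N (cminus N A)"
    have "L2_set (\<lambda>x. g (cmult N (cminus N (insert i A)) x) - g x) (configs N)
        = L2_set (\<lambda>x. (g (flip N i (?\<sigma> x)) - g (?\<sigma> x)) + (g (?\<sigma> x) - g x)) (configs N)"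
      using insert.hyps by (simp add: cminus_insert cmult_assoc)
    also have "\<dots> \<le> L2_set (\<lambda>x. g (flip N i (?\<sigma> x)) - g (?\<sigma> x)) (configs N)
        + L2_set (\<lambda>x. g (?\<sigma> x) - g x) (configs N)"
      by (rule L2_set_triangle_ineq)
    also have "L2_set (\<lambda>x. g (flip N i (?\<sigma> x)) - g (?\<sigma> x)) (configs N) \<le> sqrt M"
      unfolding L2_set_def using M(1)[of i] insert.prems
      by (subst sum_cmult[of "cminus N A" N "\<lambda>y. (g (flip N i y) - g y)\<^sup>2"]) auto
    also have "L2_set (\<lambda>x. g (?\<sigma> x) - g x) (configs N) \<le> card A * sqrt M"
      using insert by simp
    finally show ?case
      using insert.hyps by (simp add: algebra_simps)
  qed
  obtain A where A: "A \<subseteq> {1..N}" "\<tau> = cminus N A"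
    using cminus_cases[OF \<tau>] by blast
  then have "finite A" "card A \<le> N"
    using finite_subset[of A "{1..N}"] card_mono[of "{1..N}" A] by auto
  then have "L2_set (\<lambda>x. g (cmult N \<tau> x) - g x) (configs N) \<le> real N * sqrt M"
    using *[of A] A M(2) by (fastforce intro: order_trans mult_right_mono)
  then have "(L2_set (\<lambda>x. g (cmult N \<tau> x) - g x) (configs N))\<^sup>2 \<le> (real N * sqrt M)\<^sup>2"
    by (intro power_mono L2_set_nonneg)
  then show ?thesis
    using M(2) by (simp add: L2_set_def sum_nonneg power_mult_distrib)
qed

text \<open>The mean over \<open>y\<close> of the left-hand sums is an average over all
  translations, each controlled by \<open>sum_shift_diff_le\<close>; some \<open>y\<close> does no
  worse than the mean. Centring at a value \<open>g y\<close> makes the constant inherit every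
  pointwise bound on \<open>g\<close>.\<close>

lemma hypercube_poincare:
  assumes M: "\<And>i. i \<in> {1..N} \<Longrightarrow> (\<Sum>x\<in>configs N. (g (flip N i x) - g x)\<^sup>2) \<le> M" "0 \<le> M"
  shows "\<exists>y\<in>configs N. (\<Sum>x\<in>configs N. (g x - g y)\<^sup>2) \<le> (real N)\<^sup>2 * M"
proof (rule ccontr)
  let ?S = "configs N"
  assume "\<not> ?thesis"
  then have "(\<Sum>y\<in>?S. (real N)\<^sup>2 * M) < (\<Sum>y\<in>?S. \<Sum>x\<in>?S. (g x - g y)\<^sup>2)"
    by (intro sum_strict_mono) (auto simp: not_le intro: cflip_in_configs)
  \<comment> \<open>Every \<open>x\<close> is \<open>cmult N \<tau> y\<close> for exactly one
    \<tau>, so differences over all pairs become differences under translations.\<close>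
  also have "\<dots> = (\<Sum>y\<in>?S. \<Sum>\<tau>\<in>?S. (g (cmult N \<tau> y) - g y)\<^sup>2)"
  proof (rule sum.cong[OF refl])
    fix y assume "y \<in> ?S"
    from sum_cmult[OF this, of "\<lambda>x. (g x - g y)\<^sup>2"]
    show "(\<Sum>x\<in>?S. (g x - g y)\<^sup>2) = (\<Sum>\<tau>\<in>?S. (g (cmult N \<tau> y) - g y)\<^sup>2)"
      by (simp add: cmult_commute[of N y])
  qed
  also have "\<dots> = (\<Sum>\<tau>\<in>?S. \<Sum>y\<in>?S. (g (cmult N \<tau> y) - g y)\<^sup>2)"
    by (rule sum.swap)
  also have "\<dots> \<le> (\<Sum>\<tau>\<in>?S. (real N)\<^sup>2 * M)"
    by (intro sum_mono sum_shift_diff_le M)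
  finally show False by simp
qed

section \<open>Relaxation away from high sites\<close>

text \<open>The Dirichlet form of the subgraph of low sites with unit conductances. It is free of
  energies, which leaves the detour argument purely combinatorial.\<close>

definition low_form :: "nat \<Rightarrow> (config \<Rightarrow> bool) \<Rightarrow> (config \<Rightarrow> real) \<Rightarrow> real" where
  "low_form N low g = (\<Sum>x\<in>configs N. \<Sum>i=1..N.
     if low x \<and> low (flip N i x) then (g (flip N i x) - g x)\<^sup>2 else 0)"

lemma low_form_nonneg: "0 \<le> low_form N low g"
  unfolding low_form_def by (intro sum_nonneg) auto

text \<open>Cauchy-Schwarz for the five edges of the detour in
  \<open>low_neighbour_poincare\<close>.\<close>

lemma square_add5_le:
  "(a + b + c + d + e)\<^sup>2 \<le> 5 * (a\<^sup>2 + b\<^sup>2 + c\<^sup>2 + d\<^sup>2 + (e :: real)\<^sup>2)"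
proof -
  have "0 \<le> (a-b)\<^sup>2+(a-c)\<^sup>2+(a-d)\<^sup>2+(a-e)\<^sup>2+(b-c)\<^sup>2+(b-d)\<^sup>2+(b-e)\<^sup>2+(c-d)\<^sup>2+(c-e)\<^sup>2+(d-e)\<^sup>2"
    by simp
  then show ?thesis by (simp add: power2_eq_square algebra_simps)
qed

text \<open>Let \<open>k x\<close> lead from \<open>x\<close> to a low neighbour. For a flip \<open>i\<close> there is an \<open>m\<close> such
  that all inner vertices of the path from \<open>x k\<close> over \<open>x k m\<close>, \<open>x m\<close>, \<open>x i m\<close>, \<open>x i k' m\<close> to \<open>x i k'\<close>
  (where \<open>k = k x\<close> and \<open>k' = k (x i)\<close>) are low, because at most \<open>4 \<kappa> N < N\<close> choices of
  \<open>m\<close> are forbidden.\<close>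

lemma low_neighbour_poincare:
  fixes \<kappa> :: real and low :: "config \<Rightarrow> bool"
  assumes N: "0 < N" and \<kappa>: "\<kappa> < 1 / 4"
    and deg: "\<And>x. x \<in> configs N \<Longrightarrow> card {i \<in> {1..N}. \<not> low (flip N i x)} \<le> \<kappa> * real N"
    and k: "\<And>x. x \<in> configs N \<Longrightarrow> k x \<in> {1..N} \<and> low (flip N (k x) x)"
  shows "\<exists>y\<in>configs N. (\<Sum>x\<in>configs N. (g (flip N (k x) x) - g (flip N (k y) y))\<^sup>2)
           \<le> 30 * real N ^ 3 * low_form N low g"
proof -
  let ?S = "configs N"
  define e where "e y j = (if low y \<and> low (flip N j y) then (g (flip N j y) - g y)\<^sup>2 else 0)" for y j
  \<comment> \<open>Each of the five edges of the detour starts at a neighbour of \<open>x\<close>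
    or of \<open>flip N i x\<close>, so \<open>W\<close> at these two sites bounds all of them,
    whatever the choice of detour. By translation invariance the sum of \<open>W\<close> is only
    \<open>N\<close> times \<open>low_form\<close>.\<close>
  define W where "W x = (\<Sum>a=1..N. \<Sum>j=1..N. e (flip N a x) j)" for x
  define G where "G x = g (flip N (k x) x)" for x
  have e_nonneg: "0 \<le> e y j" for y j
    by (simp add: e_def)
  have e_le_W: "e (flip N a x) j \<le> W x" if "a \<in> {1..N}" "j \<in> {1..N}" for a j x
  proof -
    have "e (flip N a x) j \<le> (\<Sum>j=1..N. e (flip N a x) j)"
      using that by (intro member_le_sum) (auto simp: e_nonneg)
    also have "\<dots> \<le> W x"
      unfolding W_def using that by (intro member_le_sum[of a]) (auto simp: e_nonneg sum_nonneg)
    finally show ?thesis .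
  qed
  have sum_W: "(\<Sum>x\<in>?S. W x) = real N * low_form N low g"
  proof -
    have "(\<Sum>x\<in>?S. W x) = (\<Sum>a=1..N. \<Sum>x\<in>?S. \<Sum>j=1..N. e (flip N a x) j)"
      unfolding W_def by (rule sum.swap)
    also have "\<dots> = (\<Sum>a=1..N. \<Sum>x\<in>?S. \<Sum>j=1..N. e x j)"
      by (intro sum.cong refl sum_cmult) simp
    finally show ?thesis
      by (simp add: low_form_def e_def)
  qed
  have edge: "(G (flip N i x) - G x)\<^sup>2 \<le> 15 * (W x + W (flip N i x))" if x: "x \<in> ?S" and i: "i \<in> {1..N}" for x i
  proof -
    define x' where "x' = flip N i x"
    have x': "x' \<in> ?S" using x by (simp add: x'_def)
    define y z where "y = flip N (k x) x" and "z = flip N (k x') x'"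
    have yz: "y \<in> ?S" "z \<in> ?S" "low y" "low z" and kN: "k x \<in> {1..N}" "k x' \<in> {1..N}"
      using k[OF x] k[OF x'] x x' by (auto simp: y_def z_def)
    define bad where "bad u = {m \<in> {1..N}. \<not> low (flip N m u)}" for u
    have "card (bad y \<union> bad x \<union> bad x' \<union> bad z) \<le> card (bad y) + card (bad x) + card (bad x') + card (bad z)"
      by (meson add_le_mono1 card_Un_le order_trans)
    then have "real (card (bad y \<union> bad x \<union> bad x' \<union> bad z)) \<le> 4 * (\<kappa> * real N)"
      using deg[OF x] deg[OF x'] deg[OF yz(1)] deg[OF yz(2)] unfolding bad_def by linarith
    also have "\<dots> < real N"
      using \<kappa> N by simp
    finally have "card (bad y \<union> bad x \<union> bad x' \<union> bad z) < card {1..N}"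
      by simp
    then have "\<not> {1..N} \<subseteq> bad y \<union> bad x \<union> bad x' \<union> bad z"
      using card_mono[of "bad y \<union> bad x \<union> bad x' \<union> bad z" "{1..N}"] by (auto simp: bad_def)
    then obtain m where m: "m \<in> {1..N}" "low (flip N m y)" "low (flip N m x)" "low (flip N m x')" "low (flip N m z)"
      unfolding bad_def by blast
    have comm: "flip N (k x) (flip N m x) = flip N m y" "flip N i (flip N m x) = flip N m x'"
      "flip N (k x') (flip N m x') = flip N m z"
      by (simp_all add: y_def z_def x'_def cmult_left_commute)
    have e_eqs: "e y m = (g (flip N m y) - g y)\<^sup>2" "e z m = (g (flip N m z) - g z)\<^sup>2"
      "e (flip N m x) (k x) = (g (flip N m y) - g (flip N m x))\<^sup>2"
      "e (flip N m x) i = (g (flip N m x') - g (flip N m x))\<^sup>2"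
      "e (flip N m x') (k x') = (g (flip N m z) - g (flip N m x'))\<^sup>2"
      unfolding e_def comm using m yz by simp_all
    have G_diff: "G x' - G x = (g (flip N m y) - g y) + - (g (flip N m y) - g (flip N m x))
       + (g (flip N m x') - g (flip N m x)) + (g (flip N m z) - g (flip N m x')) + - (g (flip N m z) - g z)"
      by (simp add: G_def y_def z_def)
    have "(G x' - G x)\<^sup>2 \<le> 5 * ((g (flip N m y) - g y)\<^sup>2 + (- (g (flip N m y) - g (flip N m x)))\<^sup>2
       + (g (flip N m x') - g (flip N m x))\<^sup>2 + (g (flip N m z) - g (flip N m x'))\<^sup>2 + (- (g (flip N m z) - g z))\<^sup>2)"
      unfolding G_diff by (rule square_add5_le)
    also have "\<dots> = 5 * (e y m + e (flip N m x) (k x) + e (flip N m x) i + e (flip N m x') (k x') + e z m)"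
      by (simp only: e_eqs power2_minus)
    also have "\<dots> \<le> 5 * (W x + W x + W x + W x' + W x')"
      unfolding y_def z_def using m(1) kN i by (intro mult_left_mono add_mono e_le_W) auto
    finally have "(G x' - G x)\<^sup>2 \<le> 15 * W x + 10 * W x'"
      by simp
    also have "\<dots> \<le> 15 * (W x + W x')"
      unfolding W_def using sum_nonneg[of "{1..N}"] e_nonneg by (simp add: sum_nonneg)
    finally show ?thesis by (simp add: x'_def)
  qed
  have "\<exists>y\<in>?S. (\<Sum>x\<in>?S. (G x - G y)\<^sup>2) \<le> (real N)\<^sup>2 * (30 * real N * low_form N low g)"
  proof (rule hypercube_poincare)
    fix i assume i: "i \<in> {1..N}"
    have "(\<Sum>x\<in>?S. (G (flip N i x) - G x)\<^sup>2) \<le> (\<Sum>x\<in>?S. 15 * (W x + W (flip N i x)))"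
      by (intro sum_mono edge i)
    also have "\<dots> = 15 * ((\<Sum>x\<in>?S. W x) + (\<Sum>x\<in>?S. W (flip N i x)))"
      by (simp add: sum.distrib sum_distrib_left)
    also have "(\<Sum>x\<in>?S. W (flip N i x)) = (\<Sum>x\<in>?S. W x)"
      by (simp add: sum_cmult)
    finally show "(\<Sum>x\<in>?S. (G (flip N i x) - G x)\<^sup>2) \<le> 30 * real N * low_form N low g"
      by (simp add: sum_W)
  qed (simp add: low_form_nonneg)
  then show ?thesis
    by (simp add: G_def power2_eq_square power3_eq_cube mult_ac)
qed

section \<open>Mean-square relaxation of the Metropolis dynamics\<close>

lemma metropolis_reversible:
  "reversible_flips (configs N) {1..N} (flip N) (\<lambda>x. exp (- \<beta> * H x))
     (\<lambda>x i. exp (- \<beta> * max (H (flip N i x) - H x) 0) / real N)"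
proof
  show "exp (- \<beta> * H (flip N i x)) * (exp (- \<beta> * max (H (flip N i (flip N i x)) - H (flip N i x)) 0) / real N) =
      exp (- \<beta> * H x) * (exp (- \<beta> * max (H (flip N i x) - H x) 0) / real N)"
    if "i \<in> {1..N}" "x \<in> configs N" for i x
    using that by (simp add: max_def exp_add[symmetric] algebra_simps)
qed auto

lemma metropolis_gen:
  "reversible_flips.gen {1..N} (flip N) (\<lambda>x i. exp (- \<beta> * max (H (flip N i x) - H x) 0) / real N)
     = metropolis_generator N \<beta> H"
  unfolding fun_eq_iff reversible_flips.gen_def[OF metropolis_reversible] metropolis_generator_def
  by (simp add: sum_distrib_left)

text \<open>Passes from mean squares to mean absolute values with a free threshold \<open>l\<close>,
  so that the 1 / t bound enters linearly.\<close>

lemma abs_le_add_square_div: "0 < l \<Longrightarrow> \<bar>a\<bar> \<le> l + a\<^sup>2 / (l :: real)"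
proof -
  assume l: "0 < l"
  have "0 \<le> (\<bar>a\<bar> - l)\<^sup>2 + \<bar>a\<bar> * l" using l by simp
  then have "\<bar>a\<bar> * l \<le> l\<^sup>2 + a\<^sup>2"
    by (simp add: power2_diff algebra_simps)
  then show ?thesis
    using l by (simp add: field_simps power2_eq_square)
qed

lemma square_diff_le: "(a - c)\<^sup>2 \<le> 2 * (b - a)\<^sup>2 + 2 * (b - (c :: real))\<^sup>2"
proof -
  have "0 \<le> (a - b + (c - b))\<^sup>2" by simp
  then show ?thesis by (simp add: power2_eq_square algebra_simps)
qed

text \<open>Double counting: every site is a neighbour of exactly \<open>N\<close> sites, so a bound
  on the number of high neighbours of each site bounds the density of high sites.\<close>

lemma card_high_le:
  fixes \<kappa> :: real
  assumes N: "0 < N"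
    and deg: "\<And>x. x \<in> configs N \<Longrightarrow> card {i \<in> {1..N}. \<not> low (flip N i x)} \<le> \<kappa> * real N"
  shows "card {x \<in> configs N. \<not> low x} \<le> \<kappa> * 2 ^ N"
proof -
  let ?S = "configs N"
  let ?\<chi> = "\<lambda>x. if low x then 0 else 1 :: real"
  have "real N * card {x \<in> ?S. \<not> low x} = (\<Sum>i=1..N. \<Sum>x\<in>?S. ?\<chi> x)"
    by (simp add: sum.If_cases Int_def)
  also have "\<dots> = (\<Sum>i=1..N. \<Sum>x\<in>?S. ?\<chi> (flip N i x))"
    by (intro sum.cong refl sum_cmult[symmetric]) simp
  also have "\<dots> = (\<Sum>x\<in>?S. real (card {i \<in> {1..N}. \<not> low (flip N i x)}))"
    by (subst sum.swap) (simp add: sum.If_cases Int_def)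
  also have "\<dots> \<le> (\<Sum>x\<in>?S. \<kappa> * real N)"
    by (intro sum_mono deg)
  also have "\<dots> = real N * (\<kappa> * 2 ^ N)"
    by (simp add: card_configs)
  finally show ?thesis
    using N by simp
qed

text \<open>The bound is proved by comparing \<open>v t\<close> with one constant \<open>m\<close>, both under the uniform and
  under the Gibbs weights: by \<open>evolves_energy\<close>, the Dirichlet form of \<open>v t\<close> is at most \<open>Z / t\<close>.\<close>

lemma metropolis_relaxation:
  fixes N :: nat and H :: env and \<beta> b d \<kappa> \<theta> l t :: real
  defines "Z \<equiv> \<Sum>x\<in>configs N. exp (- \<beta> * H x)"
  assumes N: "0 < N" and \<beta>: "0 \<le> \<beta>" and b: "0 \<le> b" and d: "0 \<le> d" and \<kappa>: "\<kappa> < 1 / 4" and l: "0 < l" and t: "0 < t"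
    and deg: "\<And>x. x \<in> configs N \<Longrightarrow> card {i \<in> {1..N}. b < H (flip N i x)} \<le> \<kappa> * real N"
    and deep: "(\<Sum>x\<in>{x\<in>configs N. H x < - d}. exp (- \<beta> * H x)) \<le> \<theta> * Z" and \<theta>: "\<theta> \<le> 1 / 2"
    and v: "evolves (configs N) (metropolis_generator N \<beta> H) v"
    and v_le: "\<And>s x. 0 \<le> s \<Longrightarrow> x \<in> configs N \<Longrightarrow> \<bar>v s x\<bar> \<le> 1"
  shows "(\<Sum>x\<in>configs N. \<bar>v t x - (\<Sum>y\<in>configs N. exp (- \<beta> * H y) * v 0 y) / Z\<bar>)
     \<le> 2 ^ N * (2 * \<kappa> + 2 * \<theta> + 2 * l + 186 * real N ^ 4 * exp (\<beta> * (d + b)) / (t * l))"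
proof -
  let ?S = "configs N"
  define w where "w = (\<lambda>x. exp (- \<beta> * H x))"
  define r where "r = (\<lambda>x i. exp (- \<beta> * max (H (flip N i x) - H x) 0) / real N)"
  interpret reversible_flips ?S "{1..N}" "flip N" w r
    unfolding w_def r_def by (rule metropolis_reversible)
  have "gen = metropolis_generator N \<beta> H"
    unfolding r_def by (rule metropolis_gen)
  with v have v: "evolves ?S gen v" by simp
  define g where "g = v t"
  have g_le: "\<bar>g x\<bar> \<le> 1" if "x \<in> ?S" for x
    using v_le[of t x] t that by (simp add: g_def)
  have Z: "Z = sum w ?S" by (simp add: Z_def w_def)
  have S: "cflip N 0 \<in> ?S" by simp
  have Z_pos: "0 < Z"
    unfolding Z using S w_pos by (intro sum_pos) (auto simp del: cflip_in_configs)
  \<comment> \<open>The conductance is the weight of the higher endpoint, divided by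
    \<open>N\<close>; this symmetric form is what detailed balance amounts to here.\<close>
  have cond: "w x * r x i = exp (- \<beta> * max (H x) (H (flip N i x))) / real N" for x i
    by (simp add: w_def r_def exp_add[symmetric] max_def algebra_simps)

  have "(\<Sum>x\<in>?S. w x * (v t x)\<^sup>2) + t * dirichlet (v t) \<le> (\<Sum>x\<in>?S. w x * (v 0 x)\<^sup>2)"
    using evolves_energy[OF v, of t] t by simp
  also have "\<dots> \<le> (\<Sum>x\<in>?S. w x * 1)"
    using v_le[of 0] by (intro sum_mono mult_left_mono) (auto simp: abs_square_le_1 w_def)
  finally have "t * dirichlet g \<le> Z - (\<Sum>x\<in>?S. w x * (v t x)\<^sup>2)"
    by (simp add: Z g_def)
  also have "\<dots> \<le> Z"
    by (simp add: sum_nonneg w_def)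
  finally have dir_le: "dirichlet g \<le> Z / t"
    using t by (simp add: field_simps)

  define low where "low x = (H x \<le> b)" for x
  \<comment> \<open>The common size of the unweighted mean-square sums: \<open>real N ^ 3\<close>
    comes from \<open>low_neighbour_poincare\<close>; the remaining \<open>N\<close> and
    \<open>exp (\<beta> * b)\<close> are the inverse of the least conductance between low
    sites.\<close>
  define C where "C = real N ^ 4 * exp (\<beta> * b) * Z / t"
  have deg': "card {i \<in> {1..N}. \<not> low (flip N i x)} \<le> \<kappa> * real N" if "x \<in> ?S" for x
    using deg[OF that] by (simp add: low_def not_le)
  have "\<exists>i. i \<in> {1..N} \<and> low (flip N i x)" if x: "x \<in> ?S" for x
  proof (rule ccontr)
    assume "\<not> ?thesis"
    then have "{i \<in> {1..N}. \<not> low (flip N i x)} = {1..N}" by auto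
    with deg'[OF x] have "real N \<le> \<kappa> * real N" by simp
    also have "\<dots> < 1 / 4 * real N" using \<kappa> N by (intro mult_strict_right_mono) auto
    finally show False by simp
  qed
  then obtain k where k: "\<And>x. x \<in> ?S \<Longrightarrow> k x \<in> {1..N} \<and> low (flip N (k x) x)"
    by metis
  define G where "G x = g (flip N (k x) x)" for x
  have N3: "real N * real N ^ 3 = real N ^ 4"
    by (simp add: power3_eq_cube power4_eq_xxxx)
  have N_le: "real N \<le> real N ^ 4" "1 \<le> real N ^ 3"
    using N self_le_power[of "real N" 4] one_le_power[of "real N" 3] by auto
  have term_nonneg: "0 \<le> w x * r x i * (g (flip N i x) - g x)\<^sup>2" for x i
    unfolding cond by (intro mult_nonneg_nonneg) auto
  have low_form_le: "low_form N low g \<le> real N * exp (\<beta> * b) * (Z / t)"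
  proof -
    have "low_form N low g \<le> real N * exp (\<beta> * b) * dirichlet g"
      unfolding low_form_def dirichlet_def sum_distrib_left
    proof (intro sum_mono)
      fix x i assume "x \<in> ?S" "i \<in> {1..N}"
      show "(if low x \<and> low (flip N i x) then (g (flip N i x) - g x)\<^sup>2 else 0)
          \<le> real N * exp (\<beta> * b) * (w x * r x i * (g (flip N i x) - g x)\<^sup>2)"
      proof (cases "low x \<and> low (flip N i x)")
        case True
        then have "\<beta> * max (H x) (H (flip N i x)) \<le> \<beta> * b"
          using \<beta> by (intro mult_left_mono) (auto simp: low_def)
        then have "1 \<le> exp (\<beta> * b) * exp (- \<beta> * max (H x) (H (flip N i x)))"
          by (simp add: exp_add[symmetric])
        then have "1 \<le> real N * exp (\<beta> * b) * (w x * r x i)"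
          using N by (simp add: cond)
        from mult_right_mono[OF this, of "(g (flip N i x) - g x)\<^sup>2"] show ?thesis
          using True by (simp add: mult.assoc)
      next
        case False
        then show ?thesis
          unfolding if_not_P[OF False] using term_nonneg[of x i] by simp
      qed
    qed
    also have "\<dots> \<le> real N * exp (\<beta> * b) * (Z / t)"
      using dir_le by (intro mult_left_mono) auto
    finally show ?thesis .
  qed
  \<comment> \<open>The constant is a value of \<open>g\<close>, hence also bounded by 1.\<close>
  obtain m where m: "(\<Sum>x\<in>?S. (G x - m)\<^sup>2) \<le> 30 * C" "\<bar>m\<bar> \<le> 1"
  proof -
    obtain y where y: "y \<in> ?S" "(\<Sum>x\<in>?S. (G x - G y)\<^sup>2) \<le> 30 * real N ^ 3 * low_form N low g"
      using low_neighbour_poincare[OF N \<kappa> deg' k, of g] unfolding G_def by blast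
    note y(2)
    also have "\<dots> \<le> 30 * real N ^ 3 * (real N * exp (\<beta> * b) * (Z / t))"
      by (intro mult_left_mono low_form_le) auto
    also have "\<dots> = 30 * C"
      by (simp add: C_def N3[symmetric])
    finally show ?thesis
      using that[of "G y"] g_le[of "flip N (k y) y"] y(1) by (simp add: G_def)
  qed

  have low_part: "(\<Sum>x\<in>{x\<in>?S. low x}. (g x - m)\<^sup>2) \<le> 62 * C"
  proof -
    have "(\<Sum>x\<in>{x\<in>?S. low x}. (g x - m)\<^sup>2) \<le> (\<Sum>x\<in>{x\<in>?S. low x}. 2 * (G x - g x)\<^sup>2 + 2 * (G x - m)\<^sup>2)"
      by (intro sum_mono square_diff_le)
    also have "\<dots> = 2 * (\<Sum>x\<in>{x\<in>?S. low x}. (G x - g x)\<^sup>2) + 2 * (\<Sum>x\<in>{x\<in>?S. low x}. (G x - m)\<^sup>2)"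
      by (simp add: sum.distrib sum_distrib_left)
    also have "(\<Sum>x\<in>{x\<in>?S. low x}. (G x - m)\<^sup>2) \<le> (\<Sum>x\<in>?S. (G x - m)\<^sup>2)"
      by (intro sum_mono2) auto
    also have "(\<Sum>x\<in>{x\<in>?S. low x}. (G x - g x)\<^sup>2) \<le> low_form N low g"
    proof -
      have "(\<Sum>x\<in>{x\<in>?S. low x}. (G x - g x)\<^sup>2) \<le> (\<Sum>x\<in>{x\<in>?S. low x}. \<Sum>i=1..N.
           if low x \<and> low (flip N i x) then (g (flip N i x) - g x)\<^sup>2 else 0)"
      proof (rule sum_mono)
        fix x assume x: "x \<in> {x\<in>?S. low x}"
        have "(G x - g x)\<^sup>2 = (if low x \<and> low (flip N (k x) x) then (g (flip N (k x) x) - g x)\<^sup>2 else 0)"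
          using k[of x] x by (simp add: G_def)
        also have "\<dots> \<le> (\<Sum>i=1..N. if low x \<and> low (flip N i x) then (g (flip N i x) - g x)\<^sup>2 else 0)"
          using k[of x] x by (intro member_le_sum) auto
        finally show "(G x - g x)\<^sup>2 \<le> \<dots>" .
      qed
      also have "\<dots> \<le> low_form N low g"
        unfolding low_form_def by (intro sum_mono2) (auto intro!: sum_nonneg)
      finally show ?thesis .
    qed
    also have "low_form N low g \<le> C"
    proof -
      have "real N * exp (\<beta> * b) * (Z / t) \<le> real N ^ 4 * exp (\<beta> * b) * (Z / t)"
        using N_le Z_pos t by (intro mult_right_mono) auto
      then show ?thesis using low_form_le by (simp add: C_def)
    qed
    finally show ?thesis using m(1) by simp
  qed

  let ?D = "{x\<in>?S. H x < - d}" and ?D' = "{x\<in>?S. - d \<le> H x}"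
  \<comment> \<open>At energy at least \<open>- d\<close> the weight is at most
    \<open>exp (\<beta> * d)\<close>, so the unweighted bound for \<open>G - m\<close> transfers at
    that cost. The step from \<open>g\<close> to \<open>G\<close> uses the single edge to the low
    neighbour.\<close>
  have gibbs_part: "(\<Sum>x\<in>?D'. w x * (g x - m)\<^sup>2) \<le> 62 * exp (\<beta> * d) * C"
  proof -
    have "(\<Sum>x\<in>?D'. w x * (g x - m)\<^sup>2) \<le> (\<Sum>x\<in>?D'. w x * (2 * (G x - g x)\<^sup>2 + 2 * (G x - m)\<^sup>2))"
      using w_pos by (intro sum_mono mult_left_mono square_diff_le) (auto intro: less_imp_le)
    also have "\<dots> = 2 * (\<Sum>x\<in>?D'. w x * (G x - g x)\<^sup>2) + 2 * (\<Sum>x\<in>?D'. w x * (G x - m)\<^sup>2)"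
      by (simp add: sum.distrib sum_distrib_left distrib_left mult_ac)
    also have "(\<Sum>x\<in>?D'. w x * (G x - m)\<^sup>2) \<le> exp (\<beta> * d) * (30 * C)"
    proof -
      have "(\<Sum>x\<in>?D'. w x * (G x - m)\<^sup>2) \<le> (\<Sum>x\<in>?D'. exp (\<beta> * d) * (G x - m)\<^sup>2)"
      proof (intro sum_mono mult_right_mono)
        fix x assume "x \<in> ?D'"
        then have "\<beta> * - H x \<le> \<beta> * d"
          using \<beta> by (intro mult_left_mono) auto
        then show "w x \<le> exp (\<beta> * d)" by (simp add: w_def)
      qed auto
      also have "\<dots> = exp (\<beta> * d) * (\<Sum>x\<in>?D'. (G x - m)\<^sup>2)"
        by (simp add: sum_distrib_left)
      also have "\<dots> \<le> exp (\<beta> * d) * (\<Sum>x\<in>?S. (G x - m)\<^sup>2)"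
        by (intro mult_left_mono sum_mono2) auto
      also have "\<dots> \<le> exp (\<beta> * d) * (30 * C)"
        by (intro mult_left_mono m) auto
      finally show ?thesis .
    qed
    also have "(\<Sum>x\<in>?D'. w x * (G x - g x)\<^sup>2) \<le> exp (\<beta> * d) * C"
    proof -
      have "(\<Sum>x\<in>?D'. w x * (G x - g x)\<^sup>2)
          \<le> (\<Sum>x\<in>?D'. exp (\<beta> * (d + b)) * real N * (\<Sum>i=1..N. w x * r x i * (g (flip N i x) - g x)\<^sup>2))"
      proof (rule sum_mono)
        fix x assume x: "x \<in> ?D'"
        then have kx: "k x \<in> {1..N}" "H (flip N (k x) x) \<le> b"
          using k[of x] by (auto simp: low_def)
        \<comment> \<open>The site \<open>x\<close> may itself be high: if it lies above its low
          neighbour, the difference is 0; otherwise it is at most \<open>b + d\<close>.\<close>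
        have "\<beta> * (max (H x) (H (flip N (k x) x)) - H x) \<le> \<beta> * (d + b)"
          using \<beta> kx x b d by (intro mult_left_mono) auto
        then have "w x \<le> exp (\<beta> * (d + b)) * exp (- \<beta> * max (H x) (H (flip N (k x) x)))"
          unfolding w_def exp_add[symmetric] by (simp add: algebra_simps)
        also have "\<dots> = exp (\<beta> * (d + b)) * real N * (w x * r x (k x))"
          using N by (simp add: cond)
        finally have "w x * (G x - g x)\<^sup>2 \<le> exp (\<beta> * (d + b)) * real N * (w x * r x (k x)) * (G x - g x)\<^sup>2"
          by (intro mult_right_mono) auto
        also have "\<dots> = exp (\<beta> * (d + b)) * real N * (w x * r x (k x) * (g (flip N (k x) x) - g x)\<^sup>2)"
          by (simp add: G_def mult.assoc)
        also have "\<dots> \<le> exp (\<beta> * (d + b)) * real N * (\<Sum>i=1..N. w x * r x i * (g (flip N i x) - g x)\<^sup>2)"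
          using kx(1) term_nonneg[of x] by (intro mult_left_mono member_le_sum[of "k x"]) auto
        finally show "w x * (G x - g x)\<^sup>2
          \<le> exp (\<beta> * (d + b)) * real N * (\<Sum>i=1..N. w x * r x i * (g (flip N i x) - g x)\<^sup>2)" .
      qed
      also have "\<dots> = exp (\<beta> * (d + b)) * real N * (\<Sum>x\<in>?D'. \<Sum>i=1..N. w x * r x i * (g (flip N i x) - g x)\<^sup>2)"
        by (simp add: sum_distrib_left)
      also have "\<dots> \<le> exp (\<beta> * (d + b)) * real N * dirichlet g"
        unfolding dirichlet_def using term_nonneg
        by (intro mult_left_mono sum_mono2) (auto intro!: sum_nonneg)
      also have "\<dots> \<le> exp (\<beta> * (d + b)) * real N ^ 4 * (Z / t)"
        using dir_le N_le(1) dirichlet_nonneg by (intro mult_mono mult_left_mono) auto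
      also have "\<dots> = exp (\<beta> * d) * C"
        by (simp add: C_def distrib_left exp_add)
      finally show ?thesis .
    qed
    finally show ?thesis by (simp add: mult_ac)
  qed

  have gm: "\<bar>g x - m\<bar> \<le> 2" if "x \<in> ?S" for x
    using g_le[OF that] m(2) by linarith
  \<comment> \<open>The time-dependent error after division by \<open>Z\<close>. The final 186 is 3
    * 62: one \<open>R\<close> comes from comparing \<open>c\<close> with \<open>m\<close>, and two
    from the uniform sum, where \<open>Z_le\<close> brings a factor 2.\<close>
  define R where "R = 62 * real N ^ 4 * exp (\<beta> * (d + b)) / (t * l)"
  have R: "62 * exp (\<beta> * d) * C / l = R * Z"
    by (simp add: R_def C_def distrib_left exp_add)
  have S_split: "?S = ?D \<union> ?D'" "?D \<inter> ?D' = {}" by auto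
  define c where "c = (\<Sum>y\<in>?S. w y * v 0 y) / Z"
  have c_m: "\<bar>c - m\<bar> \<le> 2 * \<theta> + l + R"
  proof -
    \<comment> \<open>The weighted mean is conserved, so \<open>c\<close> is also the Gibbs mean of
      \<open>g\<close> and can be compared with \<open>m\<close>.\<close>
    have "(\<Sum>y\<in>?S. w y * v 0 y) = (\<Sum>x\<in>?S. w x * g x)"
      using evolves_sum_const[OF v, of t] t by (simp add: g_def)
    then have "c - m = (\<Sum>x\<in>?S. w x * (g x - m)) / Z"
      using Z_pos by (simp add: c_def Z right_diff_distrib sum_subtractf diff_divide_distrib sum_distrib_right[symmetric])
    then have "\<bar>c - m\<bar> * Z = \<bar>\<Sum>x\<in>?S. w x * (g x - m)\<bar>"
      using Z_pos by simp
    also have "\<dots> \<le> (\<Sum>x\<in>?S. w x * \<bar>g x - m\<bar>)"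
      using w_pos by (intro order_trans[OF sum_abs] sum_mono) (simp add: abs_mult less_imp_le)
    also have "\<dots> = (\<Sum>x\<in>?D. w x * \<bar>g x - m\<bar>) + (\<Sum>x\<in>?D'. w x * \<bar>g x - m\<bar>)"
      by (subst S_split(1), rule sum.union_disjoint) auto
    also have "(\<Sum>x\<in>?D. w x * \<bar>g x - m\<bar>) \<le> (\<Sum>x\<in>?D. w x * 2)"
      using w_pos gm by (intro sum_mono mult_left_mono) (auto intro: less_imp_le)
    also have "\<dots> \<le> 2 * \<theta> * Z"
      using deep by (simp add: w_def sum_distrib_right[symmetric])
    also have "(\<Sum>x\<in>?D'. w x * \<bar>g x - m\<bar>) \<le> (\<Sum>x\<in>?D'. w x * (l + (g x - m)\<^sup>2 / l))"
      using w_pos by (intro sum_mono mult_left_mono abs_le_add_square_div l) (auto intro: less_imp_le)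
    also have "\<dots> = (\<Sum>x\<in>?D'. w x) * l + (\<Sum>x\<in>?D'. w x * (g x - m)\<^sup>2) / l"
      by (simp add: distrib_left sum.distrib sum_distrib_right sum_divide_distrib)
    also have "\<dots> \<le> Z * l + R * Z"
    proof (intro add_mono mult_right_mono)
      show "(\<Sum>x\<in>?D'. w x) \<le> Z"
        unfolding Z using w_pos by (intro sum_mono2) (auto intro: less_imp_le)
      show "(\<Sum>x\<in>?D'. w x * (g x - m)\<^sup>2) / l \<le> R * Z"
        unfolding R[symmetric] using gibbs_part l by (intro divide_right_mono) auto
    qed (use l in simp)
    finally have "\<bar>c - m\<bar> * Z \<le> (2 * \<theta> + l + R) * Z"
      by (simp add: algebra_simps)
    then show ?thesis
      using Z_pos by simp
  qed
  \<comment> \<open>As \<theta> is at most 1 / 2, the deep sites carry at most half of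
    \<open>Z\<close> and can be absorbed. This replaces the random \<open>Z\<close> in the uniform
    estimate by the number of sites times the largest weight of a site that is not deep.\<close>
  have Z_le: "Z \<le> 2 * (2 ^ N * exp (\<beta> * d))"
  proof -
    have "Z = (\<Sum>x\<in>?D. w x) + (\<Sum>x\<in>?D'. w x)"
      unfolding Z by (subst S_split(1), rule sum.union_disjoint) auto
    also have "(\<Sum>x\<in>?D. w x) \<le> 1 / 2 * Z"
      unfolding w_def by (rule order_trans[OF deep mult_right_mono[OF \<theta>]]) (use Z_pos in simp)
    also have "(\<Sum>x\<in>?D'. w x) \<le> (\<Sum>x\<in>?D'. exp (\<beta> * d))"
    proof (rule sum_mono)
      fix x assume "x \<in> ?D'"
      then have "\<beta> * - H x \<le> \<beta> * d"
        using \<beta> by (intro mult_left_mono) auto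
      then show "w x \<le> exp (\<beta> * d)" by (simp add: w_def)
    qed
    also have "\<dots> \<le> (\<Sum>x\<in>?S. exp (\<beta> * d))"
      by (intro sum_mono2) auto
    finally show ?thesis by (simp add: card_configs)
  qed
  have "(\<Sum>x\<in>?S. \<bar>g x - m\<bar>) \<le> 2 ^ N * (2 * \<kappa> + l + 2 * R)"
  proof -
    have "(\<Sum>x\<in>?S. \<bar>g x - m\<bar>) = (\<Sum>x\<in>{x\<in>?S. \<not> low x} \<union> {x\<in>?S. low x}. \<bar>g x - m\<bar>)"
      by (intro sum.cong) auto
    also have "\<dots> = (\<Sum>x\<in>{x\<in>?S. \<not> low x}. \<bar>g x - m\<bar>) + (\<Sum>x\<in>{x\<in>?S. low x}. \<bar>g x - m\<bar>)"
      by (intro sum.union_disjoint) auto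
    also have "(\<Sum>x\<in>{x\<in>?S. \<not> low x}. \<bar>g x - m\<bar>) \<le> (\<Sum>x\<in>{x\<in>?S. \<not> low x}. 2)"
      using gm by (intro sum_mono) auto
    also have "\<dots> \<le> 2 ^ N * (2 * \<kappa>)"
      using card_high_le[OF N deg'] by (simp add: mult.commute)
    also have "(\<Sum>x\<in>{x\<in>?S. low x}. \<bar>g x - m\<bar>) \<le> (\<Sum>x\<in>{x\<in>?S. low x}. l + (g x - m)\<^sup>2 / l)"
      by (intro sum_mono abs_le_add_square_div l)
    also have "\<dots> = (\<Sum>x\<in>{x\<in>?S. low x}. l) + (\<Sum>x\<in>{x\<in>?S. low x}. (g x - m)\<^sup>2) / l"
      by (simp add: sum.distrib sum_divide_distrib)
    also have "(\<Sum>x\<in>{x\<in>?S. low x}. l) \<le> (\<Sum>x\<in>?S. l)"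
      using l by (intro sum_mono2) auto
    also have "(\<Sum>x\<in>{x\<in>?S. low x}. (g x - m)\<^sup>2) / l \<le> 62 * C / l"
      using low_part l by (intro divide_right_mono) auto
    also have "62 * C / l = 62 * real N ^ 4 * exp (\<beta> * b) / (t * l) * Z"
      by (simp add: C_def)
    also have "\<dots> \<le> 62 * real N ^ 4 * exp (\<beta> * b) / (t * l) * (2 * (2 ^ N * exp (\<beta> * d)))"
      using Z_le t l by (intro mult_left_mono) auto
    also have "\<dots> = 2 ^ N * (2 * R)"
      by (simp add: R_def distrib_left exp_add)
    finally show ?thesis
      by (simp add: card_configs algebra_simps)
  qed
  moreover have "(\<Sum>x\<in>?S. \<bar>g x - c\<bar>) \<le> (\<Sum>x\<in>?S. \<bar>g x - m\<bar> + \<bar>c - m\<bar>)"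
    by (intro sum_mono) linarith
  moreover have "\<dots> = (\<Sum>x\<in>?S. \<bar>g x - m\<bar>) + 2 ^ N * \<bar>c - m\<bar>"
    by (simp add: sum.distrib card_configs)
  moreover have "2 ^ N * \<bar>c - m\<bar> \<le> 2 ^ N * (2 * \<theta> + l + R)"
    using c_m by simp
  ultimately have "(\<Sum>x\<in>?S. \<bar>g x - c\<bar>) \<le> 2 ^ N * (2 * \<kappa> + l + 2 * R) + 2 ^ N * (2 * \<theta> + l + R)"
    by linarith
  also have "\<dots> = 2 ^ N * (2 * \<kappa> + 2 * \<theta> + 2 * l + 3 * R)"
    by (simp add: algebra_simps)
  finally show ?thesis
    by (simp add: g_def c_def w_def R_def mult.assoc)
qed

section \<open>Typical environments\<close>

definition rem_marginal :: "nat \<Rightarrow> real measure" where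
  "rem_marginal N = density lborel (\<lambda>x. ennreal (normal_density 0 (sqrt (real N)) x))"

lemma rem_measure_eq: "rem_measure N = (\<Pi>\<^sub>M \<sigma>\<in>configs N. rem_marginal N)"
  by (simp add: rem_measure_def rem_marginal_def)

lemma sets_rem_marginal [simp, measurable_cong]: "sets (rem_marginal N) = sets borel"
  by (simp add: rem_marginal_def)

lemma space_rem_marginal [simp]: "space (rem_marginal N) = UNIV"
  by (simp add: rem_marginal_def)

lemma prob_space_rem_marginal: "0 < N \<Longrightarrow> prob_space (rem_marginal N)"
  unfolding rem_marginal_def by (rule prob_space_normal_density) simp

lemma product_prob_space_rem: "0 < N \<Longrightarrow> product_prob_space (\<lambda>_. rem_marginal N)"
  by (rule product_prob_spaceI) (rule prob_space_rem_marginal)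

lemma prob_space_rem_measure: "0 < N \<Longrightarrow> prob_space (rem_measure N)"
  unfolding rem_measure_eq by (rule prob_space_PiM) (rule prob_space_rem_marginal)

lemma sets_rem_measure: "sets (rem_measure N) = sets (env_space N)"
  unfolding rem_measure_eq env_space_def by (rule sets_PiM_cong) auto

lemma space_rem_measure: "space (rem_measure N) = space (env_space N)"
  using sets_rem_measure by (rule sets_eq_imp_space_eq)

lemma measurable_rem_component:
  "\<sigma> \<in> configs N \<Longrightarrow> (\<lambda>H. H \<sigma>) \<in> borel_measurable (rem_measure N)"
  unfolding rem_measure_eq by simp

lemma nn_integral_rem_component:
  assumes "0 < N" "\<sigma> \<in> configs N" and f: "f \<in> borel_measurable borel"
  shows "(\<integral>\<^sup>+H. f (H \<sigma>) \<partial>rem_measure N) = (\<integral>\<^sup>+x. f x \<partial>rem_marginal N)"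
proof -
  interpret product_prob_space "\<lambda>_. rem_marginal N" "configs N"
    using assms by (simp add: product_prob_space_rem)
  have "(\<integral>\<^sup>+x. f x \<partial>rem_marginal N) =
      (\<integral>\<^sup>+x. f x \<partial>distr (rem_measure N) (rem_marginal N) (\<lambda>H. H \<sigma>))"
    unfolding rem_measure_eq using assms by (subst PiM_component) auto
  also have "\<dots> = (\<integral>\<^sup>+H. f (H \<sigma>) \<partial>rem_measure N)"
    using assms by (intro nn_integral_distr) (auto simp: rem_measure_eq measurable_cong_sets[OF sets_rem_marginal refl])
  finally show ?thesis by simp
qed

lemma measure_rem_cylinder:
  assumes N: "0 < N" and J: "J \<subseteq> configs N" and A: "A \<in> sets borel"
  shows "measure (rem_measure N) {H \<in> space (rem_measure N). \<forall>\<sigma>\<in>J. H \<sigma> \<in> A}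
     = measure (rem_marginal N) A ^ card J"
proof -
  interpret product_prob_space "\<lambda>_. rem_marginal N" "configs N"
    using N by (simp add: product_prob_space_rem)
  have "finite J"
    using J by (rule finite_subset) simp
  moreover have "{H \<in> space (rem_measure N). \<forall>\<sigma>\<in>J. H \<sigma> \<in> A} = prod_emb (configs N) (\<lambda>_. rem_marginal N) J (J \<rightarrow>\<^sub>E A)"
    using J by (auto simp: rem_measure_eq prod_emb_def space_PiM Pi_iff PiE_iff extensional_def)
  ultimately show ?thesis
    using measure_PiM_emb[of J "\<lambda>_. A"] J A by (simp add: rem_measure_eq)
qed

section \<open>Moments and tails of one Gaussian energy\<close>

lemma rem_marginal_exp_moment:
  assumes N: "0 < N"
  shows "(\<integral>\<^sup>+x. ennreal (exp (a * x)) \<partial>rem_marginal N) = ennreal (exp (a\<^sup>2 * real N / 2))"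
proof -
  interpret P: prob_space "density lborel (\<lambda>x. ennreal (normal_density (a * real N) (sqrt (real N)) x))"
    using N by (intro prob_space_normal_density) simp
  have 1: "(\<integral>\<^sup>+x. ennreal (normal_density (a * real N) (sqrt (real N)) x) \<partial>lborel) = 1"
    using P.emeasure_space_1 by (simp add: emeasure_density)
  have eq: "normal_density 0 (sqrt (real N)) x * exp (a * x)
      = exp (a\<^sup>2 * real N / 2) * normal_density (a * real N) (sqrt (real N)) x" for x
  proof -
    have "- x\<^sup>2 / (2 * real N) + a * x = a\<^sup>2 * real N / 2 + - (x - a * real N)\<^sup>2 / (2 * real N)"
      using N by (simp add: field_simps power2_eq_square)
    then have "exp (- x\<^sup>2 / (2 * real N)) * exp (a * x) = exp (a\<^sup>2 * real N / 2) * exp (- (x - a * real N)\<^sup>2 / (2 * real N))"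
      by (simp only: exp_add[symmetric])
    then show ?thesis
      by (simp add: normal_density_def)
  qed
  have "(\<integral>\<^sup>+x. ennreal (exp (a * x)) \<partial>rem_marginal N)
      = (\<integral>\<^sup>+x. ennreal (normal_density 0 (sqrt (real N)) x) * ennreal (exp (a * x)) \<partial>lborel)"
    unfolding rem_marginal_def by (intro nn_integral_density) auto
  also have "\<dots> = (\<integral>\<^sup>+x. ennreal (exp (a\<^sup>2 * real N / 2)) * ennreal (normal_density (a * real N) (sqrt (real N)) x) \<partial>lborel)"
    by (simp add: ennreal_mult[symmetric] eq)
  also have "\<dots> = ennreal (exp (a\<^sup>2 * real N / 2))"
    by (subst nn_integral_cmult) (simp_all add: 1)
  finally show ?thesis .
qed

text \<open>Under the Boltzmann weight the energy is Gaussian with mean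
  \<open>- \<beta> * N\<close>, so the event is a deviation by \<open>\<delta> * N\<close>. A
  further tilt by \<delta>, as in the Chernoff bound, shows that it costs \<delta>^2 / 2 in the
  exponent.\<close>

lemma rem_marginal_tail_moment:
  assumes N: "0 < N" and \<delta>: "0 \<le> \<delta>"
  shows "(\<integral>\<^sup>+x. (if x < - ((\<beta> + \<delta>) * real N) then ennreal (exp (- \<beta> * x)) else 0) \<partial>rem_marginal N)
      \<le> ennreal (exp (real N * (\<beta>\<^sup>2 - \<delta>\<^sup>2) / 2))"
proof -
  define c where "c = exp (- \<delta> * (\<beta> + \<delta>) * real N)"
  have "(\<integral>\<^sup>+x. (if x < - ((\<beta> + \<delta>) * real N) then ennreal (exp (- \<beta> * x)) else 0) \<partial>rem_marginal N)
      \<le> (\<integral>\<^sup>+x. ennreal c * ennreal (exp (- (\<beta> + \<delta>) * x)) \<partial>rem_marginal N)"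
  proof (rule nn_integral_mono)
    fix x
    show "(if x < - ((\<beta> + \<delta>) * real N) then ennreal (exp (- \<beta> * x)) else 0)
        \<le> ennreal c * ennreal (exp (- (\<beta> + \<delta>) * x))"
    proof (cases "x < - ((\<beta> + \<delta>) * real N)")
      case True
      then have "\<delta> * ((\<beta> + \<delta>) * real N) \<le> \<delta> * - x"
        using \<delta> by (intro mult_left_mono) auto
      then have "exp (- \<beta> * x) \<le> exp (- \<delta> * (\<beta> + \<delta>) * real N + - (\<beta> + \<delta>) * x)"
        by (simp add: algebra_simps)
      also have "\<dots> = c * exp (- (\<beta> + \<delta>) * x)"
        unfolding c_def by (rule exp_add)
      finally show ?thesis
        unfolding if_P[OF True] by (subst ennreal_mult[symmetric]) (auto simp: c_def intro: ennreal_leI)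
    qed simp
  qed
  also have "\<dots> = ennreal c * ennreal (exp ((- (\<beta> + \<delta>))\<^sup>2 * real N / 2))"
    by (subst nn_integral_cmult) (simp_all only: rem_marginal_exp_moment[OF N], measurable)
  also have "\<dots> = ennreal (exp (real N * (\<beta>\<^sup>2 - \<delta>\<^sup>2) / 2))"
    unfolding c_def by (simp add: ennreal_mult[symmetric] exp_add[symmetric] power2_eq_square field_simps)
  finally show ?thesis .
qed

lemma rem_marginal_upper_tail:
  assumes N: "0 < N" and \<eta>: "0 \<le> \<eta>"
  shows "measure (rem_marginal N) {\<eta> * real N<..} \<le> exp (- \<eta>\<^sup>2 * real N / 2)"
proof -
  interpret prob_space "rem_marginal N" using N by (rule prob_space_rem_marginal)
  have "emeasure (rem_marginal N) {\<eta> * real N<..} = (\<integral>\<^sup>+x. indicator {\<eta> * real N<..} x \<partial>rem_marginal N)"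
    by simp
  also have "\<dots> \<le> (\<integral>\<^sup>+x. ennreal (exp (- \<eta>\<^sup>2 * real N)) * ennreal (exp (\<eta> * x)) \<partial>rem_marginal N)"
  proof (rule nn_integral_mono)
    fix x
    show "indicator {\<eta> * real N<..} x \<le> ennreal (exp (- \<eta>\<^sup>2 * real N)) * ennreal (exp (\<eta> * x))"
    proof (cases "\<eta> * real N < x")
      case True
      then have "\<eta> * (\<eta> * real N) \<le> \<eta> * x"
        using \<eta> by (intro mult_left_mono) auto
      then have "1 \<le> exp (- \<eta>\<^sup>2 * real N + \<eta> * x)"
        by (simp add: power2_eq_square)
      also have "\<dots> = exp (- \<eta>\<^sup>2 * real N) * exp (\<eta> * x)"
        by (rule exp_add)
      finally show ?thesis
        using True by (simp add: ennreal_mult[symmetric])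
    qed simp
  qed
  also have "\<dots> = ennreal (exp (- \<eta>\<^sup>2 * real N)) * ennreal (exp (\<eta>\<^sup>2 * real N / 2))"
    by (subst nn_integral_cmult) (simp_all only: rem_marginal_exp_moment[OF N], measurable)
  also have "\<dots> = ennreal (exp (- \<eta>\<^sup>2 * real N / 2))"
    by (simp add: ennreal_mult[symmetric] exp_add[symmetric])
  finally show ?thesis
    by (simp add: emeasure_eq_measure)
qed

text \<open>Bounds the density from below on the unit interval ending at \<open>- a * N\<close>.
  Varying the energy by 1 costs only the constant \<bar>a\<bar> + 1 in the exponent, so the
  exponential rate is sharp.\<close>

lemma rem_marginal_lower_tail:
  assumes N: "0 < N"
  shows "exp (- a\<^sup>2 * real N / 2 - \<bar>a\<bar> - 1) / sqrt (2 * pi * real N)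
     \<le> measure (rem_marginal N) {..- a * real N}"
proof -
  interpret prob_space "rem_marginal N" using N by (rule prob_space_rem_marginal)
  let ?c = "exp (- a\<^sup>2 * real N / 2 - \<bar>a\<bar> - 1) / sqrt (2 * pi * real N)"
  let ?J = "{- a * real N - 1..- a * real N}"
  have le: "?c \<le> normal_density 0 (sqrt (real N)) x" if "x \<in> ?J" for x
  proof -
    have "\<bar>x\<bar> \<le> \<bar>a * real N\<bar> + 1"
      using that by auto
    then have "\<bar>x\<bar> \<le> \<bar>a\<bar> * real N + 1"
      by (simp add: abs_mult)
    then have "\<bar>x\<bar>\<^sup>2 \<le> (\<bar>a\<bar> * real N + 1)\<^sup>2"
      by (intro power_mono) auto
    also have "\<dots> = 2 * real N * (a\<^sup>2 * real N / 2 + \<bar>a\<bar>) + 1"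
      by (simp add: power2_eq_square algebra_simps flip: abs_mult)
    also have "\<dots> \<le> 2 * real N * (a\<^sup>2 * real N / 2 + \<bar>a\<bar> + 1)"
      using N by (simp add: algebra_simps)
    finally have "x\<^sup>2 / (2 * real N) \<le> a\<^sup>2 * real N / 2 + \<bar>a\<bar> + 1"
      using N by (simp add: divide_le_eq mult_ac)
    then have "exp (- a\<^sup>2 * real N / 2 - \<bar>a\<bar> - 1) \<le> exp (- x\<^sup>2 / (2 * real N))"
      by simp
    then show ?thesis
      by (simp add: normal_density_def divide_right_mono)
  qed
  have "ennreal ?c = (\<integral>\<^sup>+x. ennreal ?c * indicator ?J x \<partial>lborel)"
    by (subst nn_integral_cmult_indicator) auto
  also have "\<dots> \<le> (\<integral>\<^sup>+x. ennreal (normal_density 0 (sqrt (real N)) x) * indicator ?J x \<partial>lborel)"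
    using le by (intro nn_integral_mono) (auto simp: indicator_def intro!: ennreal_leI)
  also have "\<dots> = emeasure (rem_marginal N) ?J"
    unfolding rem_marginal_def by (subst emeasure_density) auto
  also have "\<dots> \<le> emeasure (rem_marginal N) {..- a * real N}"
    by (intro emeasure_mono) auto
  finally show ?thesis
    by (simp add: emeasure_eq_measure)
qed

section \<open>Probabilities of exceptional environments\<close>

lemma measure_rem_many_high_neighbours:
  assumes N: "0 < N" and \<eta>: "0 \<le> \<eta>" and \<kappa>: "0 \<le> \<kappa>"
  shows "measure (rem_measure N) {H \<in> space (rem_measure N). \<exists>x\<in>configs N.
       \<kappa> * real N < card {i \<in> {1..N}. \<eta> * real N < H (flip N i x)}}
     \<le> 4 ^ N * exp (- \<kappa> * \<eta>\<^sup>2 / 2 * (real N)\<^sup>2)"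
proof -
  let ?Q = "rem_measure N" and ?S = "configs N"
  interpret prob_space ?Q using N by (rule prob_space_rem_measure)
  note measurable_rem_component [measurable]
  \<comment> \<open>Union bound over a site and a set of more than \<kappa> N of its neighbours, all
    high. There are at most 4^N such pairs, while independence makes each event of probability
    exponentially small in N^2.\<close>
  define I where "I = ?S \<times> {A. A \<subseteq> {1..N} \<and> \<kappa> * real N < card A}"
  define E where "E = (\<lambda>(x, A). {H \<in> space ?Q. \<forall>\<sigma>\<in>(\<lambda>i. flip N i x) ` A. H \<sigma> \<in> {\<eta> * real N<..}})"
  define q where "q = measure (rem_marginal N) {\<eta> * real N<..}"
  have q: "0 \<le> q" "q \<le> exp (- \<eta>\<^sup>2 * real N / 2)"
    using rem_marginal_upper_tail[OF N \<eta>] by (auto simp: q_def)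
  have I: "finite I" "card I \<le> 2 ^ N * 2 ^ N"
  proof -
    have sub: "I \<subseteq> ?S \<times> Pow {1..N}" by (auto simp: I_def)
    then show "finite I" by (rule finite_subset) simp
    show "card I \<le> 2 ^ N * 2 ^ N"
      using card_mono[OF _ sub] by (simp add: card_configs card_Pow)
  qed
  have E_sets: "E j \<in> events" if "j \<in> I" for j
    using that unfolding E_def I_def
    by (cases j) (auto intro!: sets.sets_Collect_finite_All' intro: finite_subset)
  have E_le: "measure ?Q (E j) \<le> exp (- \<kappa> * \<eta>\<^sup>2 / 2 * (real N)\<^sup>2)" if "j \<in> I" for j
  proof -
    obtain x A where "j = (x, A)"
      by (cases j)
    with that have j: "j = (x, A)" "x \<in> ?S" "A \<subseteq> {1..N}" "\<kappa> * real N < card A"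
      by (auto simp: I_def)
    have "measure ?Q (E j) = q ^ card ((\<lambda>i. flip N i x) ` A)"
      unfolding j E_def q_def prod.case by (rule measure_rem_cylinder[OF N]) (use j in auto)
    also have "card ((\<lambda>i. flip N i x) ` A) = card A"
      using j by (intro card_image inj_on_subset[OF inj_on_flip])
    also have "q ^ card A \<le> exp (- \<eta>\<^sup>2 * real N / 2) ^ card A"
      using q by (intro power_mono)
    also have "\<dots> = exp (- \<eta>\<^sup>2 * real N / 2 * card A)"
      by (simp add: exp_of_nat_mult[symmetric] mult.commute)
    also have "\<dots> \<le> exp (- \<kappa> * \<eta>\<^sup>2 / 2 * (real N)\<^sup>2)"
    proof -
      have "\<eta>\<^sup>2 * real N / 2 * (\<kappa> * real N) \<le> \<eta>\<^sup>2 * real N / 2 * card A"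
        using j by (intro mult_left_mono) auto
      then show ?thesis by (simp add: power2_eq_square mult_ac)
    qed
    finally show ?thesis .
  qed
  have "measure ?Q {H \<in> space ?Q. \<exists>x\<in>?S. \<kappa> * real N < card {i \<in> {1..N}. \<eta> * real N < H (flip N i x)}}
      \<le> measure ?Q (\<Union>j\<in>I. E j)"
  proof (rule finite_measure_mono)
    show "{H \<in> space ?Q. \<exists>x\<in>?S. \<kappa> * real N < card {i \<in> {1..N}. \<eta> * real N < H (flip N i x)}} \<subseteq> (\<Union>j\<in>I. E j)"
    proof safe
      fix H x assume H: "H \<in> space ?Q" and x: "x \<in> ?S"
        and c: "\<kappa> * real N < card {i \<in> {1..N}. \<eta> * real N < H (flip N i x)}"
      then show "H \<in> (\<Union>j\<in>I. E j)"
        by (intro UN_I[of "(x, {i \<in> {1..N}. \<eta> * real N < H (flip N i x)})"]) (auto simp: I_def E_def)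
    qed
    show "(\<Union>j\<in>I. E j) \<in> events"
      using E_sets I(1) by auto
  qed
  also have "\<dots> \<le> (\<Sum>j\<in>I. measure ?Q (E j))"
    using E_sets I(1) by (intro measure_UNION_le) auto
  also have "\<dots> \<le> card I * exp (- \<kappa> * \<eta>\<^sup>2 / 2 * (real N)\<^sup>2)"
    using E_le by (rule sum_bounded_above)
  also have "\<dots> \<le> 4 ^ N * exp (- \<kappa> * \<eta>\<^sup>2 / 2 * (real N)\<^sup>2)"
    using of_nat_mono[OF I(2), where 'a=real]
    by (intro mult_right_mono) (simp_all add: power_mult_distrib[symmetric])
  finally show ?thesis .
qed

text \<open>Markov's inequality for the mean from \<open>rem_marginal_tail_moment\<close>. The gain
  \<delta>^2 / 2 is shared equally: half makes the event improbable, half remains in the threshold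
  for the comparison with Z.\<close>

lemma measure_rem_deep_weight:
  assumes N: "0 < N" and \<delta>: "0 \<le> \<delta>"
  shows "measure (rem_measure N) {H \<in> space (rem_measure N).
       2 ^ N * exp (real N * (\<beta>\<^sup>2 / 2 - \<delta>\<^sup>2 / 4)) \<le> (\<Sum>x\<in>{x\<in>configs N. H x < - ((\<beta> + \<delta>) * real N)}. exp (- \<beta> * H x))}
     \<le> exp (- (\<delta>\<^sup>2 / 4) * real N)"
proof -
  let ?Q = "rem_measure N" and ?S = "configs N"
  interpret prob_space ?Q using N by (rule prob_space_rem_measure)
  note measurable_rem_component [measurable]
  define f where "f x = (if x < - ((\<beta> + \<delta>) * real N) then exp (- \<beta> * x) else 0)" for x
  define c where "c = 2 ^ N * exp (real N * (\<beta>\<^sup>2 / 2 - \<delta>\<^sup>2 / 4))"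
  have [measurable]: "f \<in> borel_measurable borel"
    unfolding f_def by measurable
  have f_nonneg: "0 \<le> f x" for x by (simp add: f_def)
  have c_pos: "0 < c" by (simp add: c_def)
  have "{H \<in> space ?Q. c \<le> (\<Sum>x\<in>{x\<in>?S. H x < - ((\<beta> + \<delta>) * real N)}. exp (- \<beta> * H x))}
      = {H \<in> space ?Q. 1 \<le> ennreal (1 / c) * (\<Sum>x\<in>?S. ennreal (f (H x)))}"
    using c_pos by (auto simp: f_def[abs_def] f_nonneg[unfolded f_def] sum_ennreal ennreal_mult[symmetric] sum_nonneg sum.inter_filter[symmetric] field_simps)
  moreover have "emeasure ?Q \<dots> \<le> ennreal (1 / c) * (\<integral>\<^sup>+H. (\<Sum>x\<in>?S. ennreal (f (H x))) \<partial>?Q)"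
    using nn_integral_Markov_inequality[of "\<lambda>H. \<Sum>x\<in>?S. ennreal (f (H x))" "space ?Q" ?Q "ennreal (1 / c)"]
    by (simp cong: nn_integral_cong_simp)
  moreover have "(\<integral>\<^sup>+H. (\<Sum>x\<in>?S. ennreal (f (H x))) \<partial>?Q) \<le> ennreal (2 ^ N * exp (real N * (\<beta>\<^sup>2 - \<delta>\<^sup>2) / 2))"
  proof -
    have "(\<integral>\<^sup>+H. (\<Sum>x\<in>?S. ennreal (f (H x))) \<partial>?Q) = (\<Sum>x\<in>?S. \<integral>\<^sup>+H. ennreal (f (H x)) \<partial>?Q)"
      by (intro nn_integral_sum) measurable
    also have "\<dots> = (\<Sum>x\<in>?S. \<integral>\<^sup>+x. ennreal (f x) \<partial>rem_marginal N)"
      using N by (intro sum.cong refl nn_integral_rem_component) auto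
    also have "\<dots> \<le> (\<Sum>x\<in>?S. ennreal (exp (real N * (\<beta>\<^sup>2 - \<delta>\<^sup>2) / 2)))"
      using rem_marginal_tail_moment[OF N \<delta>, of \<beta>]
      by (intro sum_mono) (simp add: f_def if_distrib cong: if_cong)
    also have "\<dots> = ennreal (2 ^ N * exp (real N * (\<beta>\<^sup>2 - \<delta>\<^sup>2) / 2))"
      by (simp add: card_configs ennreal_mult ennreal_power[symmetric])
    finally show ?thesis .
  qed
  ultimately have "emeasure ?Q {H \<in> space ?Q. c \<le> (\<Sum>x\<in>{x\<in>?S. H x < - ((\<beta> + \<delta>) * real N)}. exp (- \<beta> * H x))}
      \<le> ennreal (1 / c) * ennreal (2 ^ N * exp (real N * (\<beta>\<^sup>2 - \<delta>\<^sup>2) / 2))"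
    by (metis (no_types, lifting) mult_left_mono order_trans zero_le)
  also have "\<dots> = ennreal (exp (- (\<delta>\<^sup>2 / 4) * real N))"
  proof -
    have "1 / c * (2 ^ N * exp (real N * (\<beta>\<^sup>2 - \<delta>\<^sup>2) / 2))
        = exp (real N * (\<beta>\<^sup>2 - \<delta>\<^sup>2) / 2) / exp (real N * (\<beta>\<^sup>2 / 2 - \<delta>\<^sup>2 / 4))"
      by (simp add: c_def)
    also have "\<dots> = exp (- (\<delta>\<^sup>2 / 4) * real N)"
      unfolding exp_diff[symmetric] by (simp add: field_simps)
    finally show ?thesis
      using c_pos by (subst ennreal_mult[symmetric]) simp_all
  qed
  finally show ?thesis
    by (simp add: emeasure_eq_measure c_def)
qed

text \<open>Chebyshev's inequality at half the mean for a sum of pairwise independent indicators,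
  whose variance is at most its mean. Counting sites serves to bound Z from below; the second moment
  of Z itself would be too large for \<beta> close to \<open>beta_c\<close>.\<close>

lemma measure_rem_few_low_sites:
  fixes u :: real
  assumes N: "0 < N"
  defines "p \<equiv> measure (rem_marginal N) {..u}"
  assumes p: "0 < p"
  shows "measure (rem_measure N) {H \<in> space (rem_measure N). real (card {x\<in>configs N. H x \<le> u}) \<le> 2 ^ N * p / 2}
     \<le> 4 / (2 ^ N * p)"
proof -
  let ?Q = "rem_measure N" and ?S = "configs N"
  interpret prob_space ?Q using N by (rule prob_space_rem_measure)
  note measurable_rem_component [measurable]
  define A where "A x = {H \<in> space ?Q. H x \<in> {..u}}" for x
  define K where "K H = (\<Sum>x\<in>?S. indicator (A x) H :: real)" for H
  define n :: real where "n = 2 ^ N"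
  have A_sets: "A x \<in> events" if "x \<in> ?S" for x
    unfolding A_def using that by measurable
  have n: "real (card ?S) = n" "1 \<le> n" by (simp_all add: card_configs n_def)
  have pr1: "prob (A x) = p" if "x \<in> ?S" for x
    using measure_rem_cylinder[OF N, of "{x}" "{..u}"] that by (simp add: A_def p_def)
  have pr2: "prob (A x \<inter> A y) = (if x = y then p else p\<^sup>2)" if "x \<in> ?S" "y \<in> ?S" for x y
  proof (cases "x = y")
    case False
    have "A x \<inter> A y = {H \<in> space ?Q. \<forall>\<sigma>\<in>{x, y}. H \<sigma> \<in> {..u}}"
      by (auto simp: A_def)
    then show ?thesis
      using measure_rem_cylinder[OF N, of "{x, y}" "{..u}"] that False
      by (simp add: p_def power2_eq_square)
  qed (use pr1 that in simp)
  have int1: "integrable ?Q (indicator (A x) :: _ \<Rightarrow> real)" if "x \<in> ?S" for x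
    using A_sets[OF that] by (simp add: integrable_indicator_iff less_top[symmetric])
  have EK: "expectation K = n * p"
    unfolding K_def using A_sets by (simp add: int1 pr1 n)
  have sq: "(K H)\<^sup>2 = (\<Sum>x\<in>?S. \<Sum>y\<in>?S. indicator (A x \<inter> A y) H)" for H
    unfolding K_def power2_eq_square sum_product indicator_inter_arith ..
  have int2: "integrable ?Q (indicator (A x \<inter> A y) :: _ \<Rightarrow> real)" if "x \<in> ?S" "y \<in> ?S" for x y
    using A_sets that by (auto simp: integrable_indicator_iff less_top[symmetric])
  have EK2: "expectation (\<lambda>H. (K H)\<^sup>2) = n * (p + (n - 1) * p\<^sup>2)"
  proof -
    have "expectation (\<lambda>H. (K H)\<^sup>2) = (\<Sum>x\<in>?S. \<Sum>y\<in>?S. if x = y then p else p\<^sup>2)"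
      unfolding sq using A_sets by (simp add: int2 pr2 sets.Int)
    also have "\<dots> = (\<Sum>x\<in>?S. p + (n - 1) * p\<^sup>2)"
    proof (rule sum.cong[OF refl])
      fix x assume x: "x \<in> ?S"
      have "(\<Sum>y\<in>?S. if x = y then p else p\<^sup>2) = p + (\<Sum>y\<in>?S - {x}. if x = y then p else p\<^sup>2)"
        using x by (subst sum.remove[of _ x]) auto
      also have "(\<Sum>y\<in>?S - {x}. if x = y then p else p\<^sup>2) = (\<Sum>y\<in>?S - {x}. p\<^sup>2)"
        by (intro sum.cong) auto
      also have "\<dots> = (n - 1) * p\<^sup>2"
        using x n by (simp add: card_Diff_singleton of_nat_diff Suc_leI card_gt_0_iff) 
      finally show "(\<Sum>y\<in>?S. if x = y then p else p\<^sup>2) = p + (n - 1) * p\<^sup>2" .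
    qed
    finally show ?thesis by (simp add: n)
  qed
  have K_meas: "random_variable borel K"
    unfolding K_def using A_sets by measurable
  have intK: "integrable ?Q K" "integrable ?Q (\<lambda>H. (K H)\<^sup>2)"
    unfolding sq using int1 int2 by (auto simp: K_def[abs_def])
  have "variance K = n * (p + (n - 1) * p\<^sup>2) - (n * p)\<^sup>2"
    using variance_eq[OF intK] by (simp only: EK EK2)
  also have "\<dots> = n * p - n * p\<^sup>2"
    by (simp add: power2_eq_square algebra_simps)
  finally have "variance K = n * p - n * p\<^sup>2" .
  then have var: "variance K \<le> n * p"
    using n by simp
  have "prob {H \<in> space ?Q. real (card {x\<in>?S. H x \<le> u}) \<le> n * p / 2}
      \<le> prob {H \<in> space ?Q. n * p / 2 \<le> \<bar>K H - expectation K\<bar>}"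
  proof (rule finite_measure_mono)
    have "K H = card {x\<in>?S. H x \<le> u}" if "H \<in> space ?Q" for H
      unfolding K_def A_def indicator_def using that by (simp add: sum.If_cases Int_def)
    then show "{H \<in> space ?Q. real (card {x\<in>?S. H x \<le> u}) \<le> n * p / 2}
        \<subseteq> {H \<in> space ?Q. n * p / 2 \<le> \<bar>K H - expectation K\<bar>}"
      by (auto simp: EK)
    show "{H \<in> space ?Q. n * p / 2 \<le> \<bar>K H - expectation K\<bar>} \<in> events"
      using K_meas by measurable
  qed
  also have "\<dots> \<le> variance K / (n * p / 2)\<^sup>2"
    using K_meas intK n p by (intro Chebyshev_inequality) auto
  also have "\<dots> \<le> n * p / (n * p / 2)\<^sup>2"
    using var by (intro divide_right_mono) auto
  also have "\<dots> = 4 / (n * p)"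
    using n p by (simp add: power2_eq_square)
  finally show ?thesis by (simp add: n_def)
qed

text \<open>The numerous sites of energy at most \<open>- a * N\<close> alone bound Z from below by
  \<open>2 ^ N * p / 2 * exp (\<beta> * a * N)\<close>.\<close>

lemma gibbs_deep_weight_le:
  assumes N: "0 < N" and \<beta>: "0 \<le> \<beta>" and p: "0 < p"
    and deep: "(\<Sum>x\<in>{x\<in>configs N. H x < - ((\<beta> + \<delta>) * real N)}. exp (- \<beta> * H x)) \<le> 2 ^ N * A"
    and low: "2 ^ N * p / 2 \<le> card {x\<in>configs N. H x \<le> - a * real N}"
    and A: "0 \<le> A"
  shows "(\<Sum>x\<in>{x\<in>configs N. H x < - ((\<beta> + \<delta>) * real N)}. exp (- \<beta> * H x))
     \<le> 2 * A * exp (- \<beta> * a * real N) / p * (\<Sum>x\<in>configs N. exp (- \<beta> * H x))"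
proof -
  let ?L = "{x\<in>configs N. H x \<le> - a * real N}"
  have "2 ^ N * p / 2 * exp (\<beta> * a * real N) \<le> card ?L * exp (\<beta> * a * real N)"
    using low by (intro mult_right_mono) auto
  also have "\<dots> \<le> (\<Sum>x\<in>?L. exp (- \<beta> * H x))"
  proof (rule sum_bounded_below)
    fix x assume "x \<in> ?L"
    then have "\<beta> * (a * real N) \<le> \<beta> * - H x"
      using \<beta> by (intro mult_left_mono) auto
    then show "exp (\<beta> * a * real N) \<le> exp (- \<beta> * H x)" by (simp add: mult.assoc)
  qed
  also have "\<dots> \<le> (\<Sum>x\<in>configs N. exp (- \<beta> * H x))"
    by (intro sum_mono2) auto
  finally have "2 * A * exp (- \<beta> * a * real N) / p * (2 ^ N * p / 2 * exp (\<beta> * a * real N))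
      \<le> 2 * A * exp (- \<beta> * a * real N) / p * (\<Sum>x\<in>configs N. exp (- \<beta> * H x))"
    using A p by (intro mult_left_mono) auto
  moreover have "2 * A * exp (- \<beta> * a * real N) / p * (2 ^ N * p / 2 * exp (\<beta> * a * real N)) = 2 ^ N * A"
    using p by (simp add: exp_minus field_simps)
  ultimately show ?thesis
    using deep by linarith
qed

lemma good_environments:
  fixes \<beta> \<delta> \<eta> \<kappa> \<theta> \<rho> :: real
  assumes \<beta>: "0 \<le> \<beta>" "\<beta> \<le> beta_c" and \<delta>: "0 < \<delta>" "\<delta> \<le> 1" and \<eta>: "0 < \<eta>" and \<kappa>: "0 < \<kappa>"
    and \<theta>: "0 < \<theta>" and \<rho>: "0 < \<rho>"
  shows "\<forall>\<^sub>F N in sequentially. \<exists>G\<in>sets (rem_measure N).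
     measure (rem_measure N) (space (rem_measure N) - G) \<le> \<rho> \<and>
     (\<forall>H\<in>G. (\<forall>x\<in>configs N. card {i \<in> {1..N}. \<eta> * real N < H (flip N i x)} \<le> \<kappa> * real N) \<and>
        (\<Sum>x\<in>{x\<in>configs N. H x < - ((\<beta> + \<delta>) * real N)}. exp (- \<beta> * H x))
          \<le> \<theta> * (\<Sum>x\<in>configs N. exp (- \<beta> * H x)))"
proof -
  \<comment> \<open>Sites of energy at most \<open>- a * N\<close> will bound Z from below. The
    shift by \<delta> / 2 gives \<bar>a\<bar> < \<open>beta_c\<close> even at \<beta> =
    \<open>beta_c\<close>, so that their expected number grows exponentially, at rate at least
    \<open>g\<close>; for small \<beta>, where \<open>a\<close> may be negative,
    \<open>1 \<le> beta_c\<close> is used.\<close>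
  define a where "a = \<beta> - \<delta> / 2"
  define pl where "pl N = exp (- a\<^sup>2 * real N / 2 - \<bar>a\<bar> - 1) / sqrt (2 * pi * real N)" for N
  define g where "g = ln 2 - a\<^sup>2 / 2"
  have "1 / 2 < ln (2 :: real)"
    using ln2_ge_two_thirds by simp
  then have "1 < 2 * ln (2 :: real)" by simp
  then have "1 \<le> beta_c"
    unfolding beta_c_def by simp
  then have "\<bar>a\<bar> < beta_c"
    using \<beta> \<delta> by (simp add: a_def abs_if)
  then have "a\<^sup>2 < beta_c\<^sup>2"
    by (metis abs_ge_zero power2_abs power_strict_mono zero_less_numeral)
  then have g: "0 < g"
    by (simp add: g_def beta_c_def)
  have pl_pos: "0 < pl N" if "0 < N" for N
    using that by (simp add: pl_def)
  have lim1: "(\<lambda>N. 4 ^ N * exp (- \<kappa> * \<eta>\<^sup>2 / 2 * (real N)\<^sup>2)) \<longlonglongrightarrow> 0"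
  proof -
    define c where "c = \<kappa> * \<eta>\<^sup>2 / 2"
    have "0 < c" using \<kappa> \<eta> by (simp add: c_def)
    then have "(\<lambda>N. 4 ^ N * exp (- c * (real N)\<^sup>2)) \<longlonglongrightarrow> 0"
      by real_asymp
    then show ?thesis by (simp add: c_def)
  qed
  have lim2: "(\<lambda>N. exp (- (\<delta>\<^sup>2 / 4) * real N)) \<longlonglongrightarrow> 0"
  proof -
    define c where "c = \<delta>\<^sup>2 / 4"
    have "0 < c" using \<delta> by (simp add: c_def)
    then have "(\<lambda>N. exp (- c * real N)) \<longlonglongrightarrow> 0"
      by real_asymp
    then show ?thesis by (simp add: c_def)
  qed
  have lim3: "(\<lambda>N. 4 / (2 ^ N * pl N)) \<longlonglongrightarrow> 0"
  proof -
    have "(\<lambda>N. 4 * exp (\<bar>a\<bar> + 1) * sqrt (2 * pi * real N) * exp (- g * real N)) \<longlonglongrightarrow> 0"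
      using g by real_asymp
    moreover have "4 / (2 ^ N * pl N) = 4 * exp (\<bar>a\<bar> + 1) * sqrt (2 * pi * real N) * exp (- g * real N)" for N
    proof -
      have "2 ^ N = exp (ln 2 * real N)"
        by (simp add: exp_of_nat2_mult)
      then have *: "2 ^ N * exp (- a\<^sup>2 * real N / 2 - \<bar>a\<bar> - 1) = exp (- (- g * real N)) * exp (- (\<bar>a\<bar> + 1))"
        by (simp add: exp_add[symmetric] g_def algebra_simps)
      have "4 / (2 ^ N * pl N) = 4 * sqrt (2 * pi * real N) / (2 ^ N * exp (- a\<^sup>2 * real N / 2 - \<bar>a\<bar> - 1))"
        by (simp add: pl_def)
      also have "\<dots> = 4 * exp (\<bar>a\<bar> + 1) * sqrt (2 * pi * real N) * exp (- g * real N)"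
        unfolding * by (subst (1 2) exp_minus) (simp add: field_simps)
      finally show ?thesis .
    qed
    ultimately show ?thesis by simp
  qed
  \<comment> \<open>Up to subexponential factors the exponent per unit of \<open>N\<close> is
    (\<beta> - a)^2 / 2 - \<delta>^2 / 4 = - \<delta>^2 / 8. The choice of \<open>a\<close> keeps
    the first term below the gain left by \<open>measure_rem_deep_weight\<close>.\<close>
  have lim4: "(\<lambda>N. 2 * exp (real N * (\<beta>\<^sup>2 / 2 - \<delta>\<^sup>2 / 4)) * exp (- \<beta> * a * real N) / pl N) \<longlonglongrightarrow> 0"
  proof -
    define c where "c = \<delta>\<^sup>2 / 8"
    have "0 < c" using \<delta> by (simp add: c_def)
    then have "(\<lambda>N. 2 * exp (\<bar>a\<bar> + 1) * sqrt (2 * pi * real N) * exp (- c * real N)) \<longlonglongrightarrow> 0"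
      by real_asymp
    moreover have "2 * exp (real N * (\<beta>\<^sup>2 / 2 - \<delta>\<^sup>2 / 4)) * exp (- \<beta> * a * real N) / pl N
        = 2 * exp (\<bar>a\<bar> + 1) * sqrt (2 * pi * real N) * exp (- c * real N)" for N
    proof -
      have "real N * (\<beta>\<^sup>2 / 2 - \<delta>\<^sup>2 / 4) + - \<beta> * a * real N
          = (- a\<^sup>2 * real N / 2 - \<bar>a\<bar> - 1) + (\<bar>a\<bar> + 1) + - c * real N"
        by (simp add: a_def c_def power2_eq_square field_simps)
      then have "exp (real N * (\<beta>\<^sup>2 / 2 - \<delta>\<^sup>2 / 4)) * exp (- \<beta> * a * real N)
          = exp (- a\<^sup>2 * real N / 2 - \<bar>a\<bar> - 1) * exp (\<bar>a\<bar> + 1) * exp (- c * real N)"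
        by (simp only: exp_add[symmetric])
      then have "2 * exp (real N * (\<beta>\<^sup>2 / 2 - \<delta>\<^sup>2 / 4)) * exp (- \<beta> * a * real N)
          = exp (- a\<^sup>2 * real N / 2 - \<bar>a\<bar> - 1) * (2 * exp (\<bar>a\<bar> + 1) * exp (- c * real N))"
        by (simp only: mult.assoc mult.left_commute[of _ 2])
      then show ?thesis
        unfolding pl_def by (simp only: divide_divide_eq_right) (simp add: mult_ac)
    qed
    ultimately show ?thesis by simp
  qed
  have "\<forall>\<^sub>F N in sequentially. 0 < N \<and> 4 ^ N * exp (- \<kappa> * \<eta>\<^sup>2 / 2 * (real N)\<^sup>2) < \<rho> / 3 \<and>
      exp (- (\<delta>\<^sup>2 / 4) * real N) < \<rho> / 3 \<and> 4 / (2 ^ N * pl N) < \<rho> / 3 \<and>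
      2 * exp (real N * (\<beta>\<^sup>2 / 2 - \<delta>\<^sup>2 / 4)) * exp (- \<beta> * a * real N) / pl N < \<theta>"
    using \<rho> \<theta> by (intro eventually_conj eventually_gt_at_top order_tendstoD(2)[OF lim1] order_tendstoD(2)[OF lim2]
        order_tendstoD(2)[OF lim3] order_tendstoD(2)[OF lim4]) auto
  then show ?thesis
  proof eventually_elim
    case (elim N)
    then have N: "0 < N" by simp
    let ?Q = "rem_measure N" and ?S = "configs N"
    interpret prob_space ?Q using N by (rule prob_space_rem_measure)
    note measurable_rem_component [measurable]
    define p where "p = measure (rem_marginal N) {..- a * real N}"
    have pl_p: "pl N \<le> p"
      unfolding pl_def p_def by (rule rem_marginal_lower_tail[OF N])
    then have p: "0 < p"
      using pl_pos[OF N] by simp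
    define A where "A = exp (real N * (\<beta>\<^sup>2 / 2 - \<delta>\<^sup>2 / 4))"
    let ?deep = "\<lambda>H. (\<Sum>x\<in>{x\<in>?S. H x < - ((\<beta> + \<delta>) * real N)}. exp (- \<beta> * H x))"
    define E1 where "E1 = {H \<in> space ?Q. \<exists>x\<in>?S. \<kappa> * real N < card {i \<in> {1..N}. \<eta> * real N < H (flip N i x)}}"
    define E2 where "E2 = {H \<in> space ?Q. 2 ^ N * A \<le> ?deep H}"
    define E3 where "E3 = {H \<in> space ?Q. real (card {x\<in>?S. H x \<le> - a * real N}) \<le> 2 ^ N * p / 2}"
    have card_eq: "real (card {x \<in> X. P x}) = (\<Sum>x\<in>X. if P x then 1 else 0)" if "finite X" for P and X :: "'b set"
      using that by (simp add: sum.If_cases Int_def)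
    have E1_sets [measurable]: "E1 \<in> events"
      unfolding E1_def card_eq[OF finite_atLeastAtMost] by (intro sets.sets_Collect_finite_Ex) (simp_all, measurable)
    have E2_sets [measurable]: "E2 \<in> events"
      unfolding E2_def by (simp add: sum.inter_filter) measurable
    have E3_sets [measurable]: "E3 \<in> events"
      unfolding E3_def card_eq[OF finite_configs] by measurable
    have "measure ?Q (E1 \<union> E2 \<union> E3) \<le> measure ?Q E1 + measure ?Q E2 + measure ?Q E3"
      using measure_Un_le[of E1 ?Q E2] measure_Un_le[of "E1 \<union> E2" ?Q E3] by simp
    also have "measure ?Q E1 \<le> \<rho> / 3"
      using measure_rem_many_high_neighbours[OF N less_imp_le[OF \<eta>] less_imp_le[OF \<kappa>]] elim
      unfolding E1_def by linarith
    also have "measure ?Q E2 \<le> \<rho> / 3"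
      using measure_rem_deep_weight[OF N less_imp_le[OF \<delta>(1)], of \<beta>] elim
      unfolding E2_def A_def by linarith
    also have "measure ?Q E3 \<le> \<rho> / 3"
    proof -
      have "measure ?Q E3 \<le> 4 / (2 ^ N * p)"
        using measure_rem_few_low_sites[OF N, of "- a * real N"] p unfolding E3_def p_def by simp
      also have "\<dots> \<le> 4 / (2 ^ N * pl N)"
        using pl_p p pl_pos[OF N] by (intro divide_left_mono) auto
      finally show ?thesis using elim by linarith
    qed
    finally have bad: "measure ?Q (E1 \<union> E2 \<union> E3) \<le> \<rho>" by simp
    show ?case
    proof (intro bexI conjI ballI)
      have "space ?Q - (space ?Q - (E1 \<union> E2 \<union> E3)) = E1 \<union> E2 \<union> E3"
        using sets.sets_into_space[OF E1_sets] sets.sets_into_space[OF E2_sets] sets.sets_into_space[OF E3_sets] by auto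
      then show "measure ?Q (space ?Q - (space ?Q - (E1 \<union> E2 \<union> E3))) \<le> \<rho>"
        using bad by simp
      fix H assume H: "H \<in> space ?Q - (E1 \<union> E2 \<union> E3)"
      then show "card {i \<in> {1..N}. \<eta> * real N < H (flip N i x)} \<le> \<kappa> * real N" if "x \<in> ?S" for x
        using that by (auto simp: E1_def not_less)
      have "?deep H \<le> 2 * A * exp (- \<beta> * a * real N) / p * (\<Sum>x\<in>?S. exp (- \<beta> * H x))"
        by (rule gibbs_deep_weight_le[OF N \<beta>(1) p]) (use H in \<open>auto simp: E2_def E3_def A_def\<close>)
      also have "\<dots> \<le> \<theta> * (\<Sum>x\<in>?S. exp (- \<beta> * H x))"
      proof (rule mult_right_mono)
        have "2 * A * exp (- \<beta> * a * real N) / p \<le> 2 * A * exp (- \<beta> * a * real N) / pl N"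
          using pl_p p pl_pos[OF N] by (intro divide_left_mono) (auto simp: A_def)
        then show "2 * A * exp (- \<beta> * a * real N) / p \<le> \<theta>"
          using elim unfolding A_def by linarith
      qed (simp add: sum_nonneg)
      finally show "?deep H \<le> \<theta> * (\<Sum>x\<in>?S. exp (- \<beta> * H x))" .
    qed measurable
  qed
qed

section \<open>Averaging over the starting configuration\<close>

text \<open>The joint law at the two times 0 and \<open>s\<close>, summed over the state at time 0,
  gives the law of \<open>X s\<close>. The matrices \<open>P\<close> obtained here also describe all
  other starting states, which the process itself never visits at time 0 almost surely.\<close>

lemma markov_process_integral:
  fixes M :: "'w measure" and X :: "real \<Rightarrow> 'w \<Rightarrow> 's"
  assumes X: "markov_process M X S L x0" and S: "finite S" "x0 \<in> S"
  obtains P where "markov_semigroup S P" "semigroup_has_generator S P L"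
    "\<And>s f. 0 \<le> s \<Longrightarrow> (\<integral>w. f (X s w) \<partial>M) = (\<Sum>y\<in>S. P s x0 y * (f y :: real))"
proof -
  interpret prob_space M using X by (simp add: markov_process_def)
  have meas: "X t \<in> measurable M (count_space S)" if "0 \<le> t" for t
    using X that by (simp add: markov_process_def)
  obtain P where P: "markov_semigroup S P" "semigroup_has_generator S P L"
    and fdd: "\<And>n t x. t 0 = 0 \<Longrightarrow> (\<forall>k<n. t k \<le> t (Suc k)) \<Longrightarrow> (\<forall>k\<le>n. x k \<in> S) \<Longrightarrow>
          measure M {w \<in> space M. \<forall>k\<le>n. X (t k) w = x k} =
            (if x 0 = x0 then 1 else 0) * (\<Prod>k<n. P (t (Suc k) - t k) (x k) (x (Suc k)))"
    using X unfolding markov_process_def by blast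
  have prob_eq: "prob {w \<in> space M. X s w = y} = P s x0 y" if s: "0 \<le> s" and y: "y \<in> S" for s y
  proof -
    have joint: "prob {w \<in> space M. X 0 w = x \<and> X s w = y} = (if x = x0 then P s x0 y else 0)" if "x \<in> S" for x
      using fdd[of "\<lambda>k. if k = 0 then 0 else s" 1 "\<lambda>k. if k = 0 then x else y"] s y that
      by (auto simp: le_Suc_eq all_conj_distrib imp_conjR cong: conj_cong)
    have "{w \<in> space M. X s w = y} = (\<Union>x\<in>S. {w \<in> space M. X 0 w = x \<and> X s w = y})"
      using measurable_space[OF meas[of 0]] by auto
    also have "prob \<dots> = (\<Sum>x\<in>S. prob {w \<in> space M. X 0 w = x \<and> X s w = y})"
    proof (rule finite_measure_finite_Union)
      have "{w \<in> space M. X 0 w = x \<and> X s w = y} = (X 0 -` {x} \<inter> space M) \<inter> (X s -` {y} \<inter> space M)" for x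
        by auto
      then show "(\<lambda>x. {w \<in> space M. X 0 w = x \<and> X s w = y}) ` S \<subseteq> events"
        using measurable_sets[OF meas[of 0]] measurable_sets[OF meas[OF s]] y by auto
    qed (use S in \<open>auto simp: disjoint_family_on_def\<close>)
    also have "\<dots> = P s x0 y"
      using S by (simp add: joint sum.delta)
    finally show ?thesis .
  qed
  have "(\<integral>w. f (X s w) \<partial>M) = (\<Sum>y\<in>S. P s x0 y * f y)" if s: "0 \<le> s" for s and f :: "'s \<Rightarrow> real"
  proof -
    have A_sets: "{w \<in> space M. X s w = y} \<in> events" if "y \<in> S" for y
    proof -
      have "{w \<in> space M. X s w = y} = X s -` {y} \<inter> space M" by auto
      then show ?thesis
        using measurable_sets[OF meas[OF s], of "{y}"] that by simp
    qed
    have "(\<integral>w. f (X s w) \<partial>M) = (\<integral>w. (\<Sum>y\<in>S. indicator {w \<in> space M. X s w = y} w * f y) \<partial>M)"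
    proof (rule Bochner_Integration.integral_cong[OF refl])
      fix w assume w: "w \<in> space M"
      then have "X s w \<in> S"
        using measurable_space[OF meas[OF s]] by simp
      moreover have "indicator {w \<in> space M. X s w = y} w * f y = (if y = X s w then f y else 0)" for y
        using w by (simp add: indicator_def)
      ultimately show "f (X s w) = (\<Sum>y\<in>S. indicator {w \<in> space M. X s w = y} w * f y)"
        using S by simp
    qed
    also have "\<dots> = (\<Sum>y\<in>S. \<integral>w. indicator {w \<in> space M. X s w = y} w * f y \<partial>M)"
      using A_sets by (intro Bochner_Integration.integral_sum integrable_mult_left)
        (simp add: integrable_indicator_iff less_top[symmetric])
    also have "\<dots> = (\<Sum>y\<in>S. P s x0 y * f y)"
      using A_sets by (intro sum.cong refl) (simp add: prob_eq[OF s])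
    finally show ?thesis .
  qed
  then show ?thesis
    using that P by blast
qed

section \<open>Equivariance under translations of the hypercube\<close>

lemma env_act_env_act:
  assumes "\<sigma> \<in> configs N" "\<tau> \<in> configs N"
  shows "env_act N \<sigma> (env_act N \<tau> H) = env_act N (cmult N \<tau> \<sigma>) H"
  using assms by (auto simp: env_act_def cmult_assoc)

lemma env_act_apply: "\<sigma>' \<in> configs N \<Longrightarrow> env_act N \<sigma> h \<sigma>' = h (cmult N \<sigma> \<sigma>')"
  by (simp add: env_act_def)

lemma env_act_in_space: "env_act N \<tau> H \<in> space (env_space N)"
  by (auto simp: env_act_def env_space_def space_PiM)

lemma metropolis_generator_env_act:
  assumes "\<tau> \<in> configs N" "x \<in> configs N"
  shows "metropolis_generator N \<beta> (env_act N \<tau> H) f (cmult N \<tau> x)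
     = metropolis_generator N \<beta> H (\<lambda>y. f (cmult N \<tau> y)) x"
proof -
  have "flip N i (cmult N \<tau> x) = cmult N \<tau> (flip N i x)" for i
    by (rule cmult_left_commute)
  then show ?thesis
    using assms by (simp add: metropolis_generator_def env_act_def)
qed

text \<open>Moving the environment by \<tau> is the same as moving the starting site by \<tau>. The
  solutions for the two environments may come from unrelated processes, so they are identified by
  uniqueness: \<open>v\<close> composed with \<tau> solves the equation for \<open>H\<close> with
  the initial data of \<open>u\<close>.\<close>

lemma evolves_env_act:
  assumes \<tau>: "\<tau> \<in> configs N" and x: "x \<in> configs N" and t: "0 \<le> t"
    and u: "evolves (configs N) (metropolis_generator N \<beta> H) u"
    and u0: "\<And>y. y \<in> configs N \<Longrightarrow> u 0 y = \<phi> (env_act N y H)"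
    and v: "evolves (configs N) (metropolis_generator N \<beta> (env_act N \<tau> H)) v"
    and v0: "\<And>y. y \<in> configs N \<Longrightarrow> v 0 y = \<phi> (env_act N y (env_act N \<tau> H))"
  shows "v t x = u t (cmult N \<tau> x)"
proof -
  have "evolves (configs N) (metropolis_generator N \<beta> H) (\<lambda>t y. v t (cmult N \<tau> y))"
    using evolvesD[OF v] \<tau> unfolding evolves_def
    by (metis cmult_in_configs metropolis_generator_env_act)
  moreover have "v 0 (cmult N \<tau> y) = u 0 y" if "y \<in> configs N" for y
    using that \<tau> by (simp add: u0 v0 env_act_env_act)
  ultimately have "v t (cmult N \<tau> (cmult N \<tau> x)) = u t (cmult N \<tau> x)"
    by (rule reversible_flips.evolves_unique[OF metropolis_reversible, unfolded metropolis_gen, OF _ u])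
      (use t \<tau> x in simp_all)
  then show ?thesis
    using \<tau> x by simp
qed

lemma env_equilibrium_env_act:
  assumes \<tau>: "\<tau> \<in> configs N"
  shows "env_equilibrium N \<beta> (env_act N \<tau> H) \<phi> = env_equilibrium N \<beta> H \<phi>"
proof -
  have "(\<Sum>\<sigma>\<in>configs N. exp (- \<beta> * env_act N \<tau> H \<sigma>)) = (\<Sum>\<sigma>\<in>configs N. exp (- \<beta> * H \<sigma>))"
    using sum_cmult[OF \<tau>, of "\<lambda>\<sigma>. exp (- \<beta> * H \<sigma>)"] by (simp add: env_act_apply)
  then have "\<phi> (env_act N \<sigma> (env_act N \<tau> H)) * gibbs N \<beta> (env_act N \<tau> H) \<sigma>
      = \<phi> (env_act N (cmult N \<tau> \<sigma>) H) * gibbs N \<beta> H (cmult N \<tau> \<sigma>)" if "\<sigma> \<in> configs N" for \<sigma>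
    using that \<tau> by (simp add: env_act_env_act gibbs_def env_act_apply)
  then show ?thesis
    unfolding env_equilibrium_def
    using sum_cmult[OF \<tau>, of "\<lambda>\<sigma>. \<phi> (env_act N \<sigma> H) * gibbs N \<beta> H \<sigma>"] by simp
qed

lemma measurable_env_act: "\<tau> \<in> configs N \<Longrightarrow> env_act N \<tau> \<in> measurable (rem_measure N) (rem_measure N)"
  unfolding rem_measure_eq env_act_def by (intro measurable_restrict measurable_component_singleton) simp

lemma distr_env_act:
  assumes N: "0 < N" and \<tau>: "\<tau> \<in> configs N"
  shows "distr (rem_measure N) (rem_measure N) (env_act N \<tau>) = rem_measure N"
proof -
  have "inj_on (cmult N \<tau>) (configs N)"
    by (rule inj_on_inverseI[of _ "cmult N \<tau>"]) (use \<tau> in simp)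
  then show ?thesis
    using distr_PiM_reindex[of "configs N" "\<lambda>_. rem_marginal N" "cmult N \<tau>" "configs N"] prob_space_rem_marginal[OF N] \<tau>
    by (simp add: rem_measure_eq env_act_def[abs_def] Pi_iff)
qed

text \<open>The function \<open>f\<close> need not be measurable: its integral is a supremum over simple functions
  below \<open>f\<close>, and these can be averaged over the group.\<close>

lemma nn_integral_rem_le_average:
  fixes f :: "env \<Rightarrow> ennreal" and e \<rho> :: real
  assumes N: "0 < N" and G: "G \<in> sets (rem_measure N)"
    and bad: "measure (rem_measure N) (space (rem_measure N) - G) \<le> \<rho>"
    and f_le: "\<And>H. H \<in> space (rem_measure N) \<Longrightarrow> f H \<le> 2"
    and avg: "\<And>H. H \<in> G \<Longrightarrow> (\<Sum>\<tau>\<in>configs N. f (env_act N \<tau> H)) \<le> 2 ^ N * ennreal e"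
    and e: "0 \<le> e"
  shows "(\<integral>\<^sup>+H. f H \<partial>rem_measure N) \<le> ennreal (e + 2 * \<rho>)"
  unfolding nn_integral_def[of _ f]
proof (rule SUP_least)
  let ?Q = "rem_measure N" and ?S = "configs N"
  interpret prob_space ?Q using N by (rule prob_space_rem_measure)
  fix g assume "g \<in> {g. simple_function ?Q g \<and> g \<le> f}"
  then have simple: "simple_function ?Q g" and gf: "g H \<le> f H" for H
    by (auto simp: le_fun_def)
  have g [measurable]: "g \<in> borel_measurable ?Q"
    using simple by (rule borel_measurable_simple_function)
  have \<rho>: "0 \<le> \<rho>"
    using bad measure_nonneg order_trans by blast
  have shift: "(\<integral>\<^sup>+H. g (env_act N \<tau> H) \<partial>?Q) = (\<integral>\<^sup>+H. g H \<partial>?Q)" if "\<tau> \<in> ?S" for \<tau>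
    using nn_integral_distr[OF measurable_env_act[OF that], of g] distr_env_act[OF N that] by simp
  have "2 ^ N * (\<integral>\<^sup>+H. g H \<partial>?Q) = (\<Sum>\<tau>\<in>?S. \<integral>\<^sup>+H. g (env_act N \<tau> H) \<partial>?Q)"
    by (simp add: shift card_configs)
  also have "\<dots> = (\<integral>\<^sup>+H. (\<Sum>\<tau>\<in>?S. g (env_act N \<tau> H)) \<partial>?Q)"
    by (rule nn_integral_sum[symmetric]) (rule measurable_compose[OF measurable_env_act g])
  also have "\<dots> \<le> (\<integral>\<^sup>+H. 2 ^ N * ennreal e + 2 ^ N * (2 * indicator (space ?Q - G) H) \<partial>?Q)"
  proof (rule nn_integral_mono)
    fix H assume H: "H \<in> space ?Q"
    show "(\<Sum>\<tau>\<in>?S. g (env_act N \<tau> H)) \<le> 2 ^ N * ennreal e + 2 ^ N * (2 * indicator (space ?Q - G) H)"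
    proof (cases "H \<in> G")
      case True
      have "(\<Sum>\<tau>\<in>?S. g (env_act N \<tau> H)) \<le> (\<Sum>\<tau>\<in>?S. f (env_act N \<tau> H))"
        by (intro sum_mono gf)
      also have "\<dots> \<le> 2 ^ N * ennreal e"
        by (rule avg[OF True])
      finally show ?thesis by (simp add: add_increasing2)
    next
      case False
      have "(\<Sum>\<tau>\<in>?S. g (env_act N \<tau> H)) \<le> (\<Sum>\<tau>\<in>?S. 2)"
        by (intro sum_mono order_trans[OF gf] f_le) (simp add: space_rem_measure env_act_in_space)
      also have "\<dots> = 2 ^ N * 2"
        by (simp add: card_configs)
      finally show ?thesis
        using False H by (simp add: add_increasing)
    qed
  qed
  also have "\<dots> = 2 ^ N * (ennreal e + 2 * emeasure ?Q (space ?Q - G))"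
    using G by (simp add: nn_integral_add nn_integral_cmult emeasure_space_1 distrib_left)
  also have "\<dots> \<le> 2 ^ N * ennreal (e + 2 * \<rho>)"
  proof -
    have "2 * emeasure ?Q (space ?Q - G) \<le> 2 * ennreal \<rho>"
      using bad by (intro mult_left_mono) (simp_all add: emeasure_eq_measure ennreal_leI)
    also have "\<dots> = ennreal (2 * \<rho>)"
      using \<rho> by (simp add: ennreal_mult)
    finally show ?thesis
      using e \<rho> by (intro mult_left_mono) (simp_all add: ennreal_plus)
  qed
  finally have "(\<integral>\<^sup>+H. g H \<partial>?Q) \<le> ennreal (e + 2 * \<rho>)"
    by (subst (asm) ennreal_mult_le_mult_iff) (auto simp: power_eq_top_ennreal)
  then show "integral\<^sup>S ?Q g \<le> ennreal (e + 2 * \<rho>)"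
    by (simp add: nn_integral_eq_simple_integral[OF simple])
qed

section \<open>The averaged equilibration time\<close>

lemma abs_gibbs_average_le_1:
  assumes "\<And>x. x \<in> configs N \<Longrightarrow> \<bar>a x\<bar> \<le> 1"
  shows "\<bar>\<Sum>x\<in>configs N. a x * gibbs N \<beta> H x\<bar> \<le> 1"
proof -
  have "0 < (\<Sum>x\<in>configs N. exp (- \<beta> * H x))"
    by (rule sum_pos2[of _ "cflip N 0"]) auto
  then have gibbs: "0 \<le> gibbs N \<beta> H x" "(\<Sum>x\<in>configs N. gibbs N \<beta> H x) = 1" for x
    by (auto simp: gibbs_def sum_divide_distrib[symmetric])
  have "\<bar>\<Sum>x\<in>configs N. a x * gibbs N \<beta> H x\<bar> \<le> (\<Sum>x\<in>configs N. \<bar>a x * gibbs N \<beta> H x\<bar>)"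
    by (rule sum_abs)
  also have "\<dots> \<le> (\<Sum>x\<in>configs N. gibbs N \<beta> H x)"
    using assms gibbs by (intro sum_mono) (simp add: abs_mult mult_left_le_one_le)
  finally show ?thesis by (simp add: gibbs)
qed

text \<open>Each process starts only from \<sigma>, but its semigroup defines \<open>U\<close> for
  all starting sites. Replacing \<open>H\<close> by its translate under \<tau> changes the value at
  \<sigma> into the value at \<tau>.\<sigma> and leaves the equilibrium mean \<open>c\<close> fixed,
  so averaging over \<tau> gives exactly the sum bounded in \<open>metropolis_relaxation\<close>.
  Outside \<open>G\<close> the trivial bound 2 applies, whence 2 \<rho>. The semigroups are chosen
  separately for each \<open>H\<close>, with no measurability in \<open>H\<close>.\<close>

lemma averaged_distance_le:
  fixes N :: nat and \<sigma> :: config and M :: "env \<Rightarrow> 'w measure" and X :: "env \<Rightarrow> real \<Rightarrow> 'w \<Rightarrow> config"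
    and \<beta> b d \<kappa> \<theta> l s \<rho> :: real
  assumes N: "0 < N" and \<beta>: "0 \<le> \<beta>" and b: "0 \<le> b" and d: "0 \<le> d"
    and \<kappa>: "0 \<le> \<kappa>" "\<kappa> < 1 / 4" and \<theta>: "0 \<le> \<theta>" "\<theta> \<le> 1 / 2" and l: "0 < l" and s: "0 < s"
    and \<sigma>: "\<sigma> \<in> configs N"
    and proc: "\<And>H. H \<in> space (env_space N) \<Longrightarrow> metropolis_process N \<beta> H \<sigma> (M H) (X H)"
    and \<phi>: "\<phi> \<in> test_functions N"
    and G: "G \<in> sets (rem_measure N)" "measure (rem_measure N) (space (rem_measure N) - G) \<le> \<rho>"
    and deg: "\<And>H x. H \<in> G \<Longrightarrow> x \<in> configs N \<Longrightarrow> card {i \<in> {1..N}. b < H (flip N i x)} \<le> \<kappa> * real N"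
    and deep: "\<And>H. H \<in> G \<Longrightarrow> (\<Sum>x\<in>{x\<in>configs N. H x < - d}. exp (- \<beta> * H x))
        \<le> \<theta> * (\<Sum>x\<in>configs N. exp (- \<beta> * H x))"
  shows "(\<integral>\<^sup>+H. ennreal \<bar>(\<integral>w. \<phi> (env_process N H (X H) s w) \<partial>M H) - env_equilibrium N \<beta> H \<phi>\<bar> \<partial>rem_measure N)
     \<le> ennreal (2 * \<kappa> + 2 * \<theta> + 2 * l + 186 * real N ^ 4 * exp (\<beta> * (d + b)) / (s * l) + 2 * \<rho>)"
proof -
  let ?S = "configs N"
  have "\<forall>H\<in>space (env_space N). \<exists>P. markov_semigroup ?S P \<and>
      semigroup_has_generator ?S P (metropolis_generator N \<beta> H) \<and>
      (\<forall>t f. 0 \<le> t \<longrightarrow> (\<integral>w. f (X H t w) \<partial>M H) = (\<Sum>y\<in>?S. P t \<sigma> y * (f y :: real)))"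
    by (metis markov_process_integral[OF proc[unfolded metropolis_process_def] finite_configs \<sigma>])
  then obtain P where P: "\<And>H. H \<in> space (env_space N) \<Longrightarrow> markov_semigroup ?S (P H)"
      "\<And>H. H \<in> space (env_space N) \<Longrightarrow> semigroup_has_generator ?S (P H) (metropolis_generator N \<beta> H)"
      "\<And>H t f. H \<in> space (env_space N) \<Longrightarrow> 0 \<le> t \<Longrightarrow>
         (\<integral>w. f (X H t w) \<partial>M H) = (\<Sum>y\<in>?S. P H t \<sigma> y * (f y :: real))"
    by metis
  define U where "U H t x = (\<Sum>y\<in>?S. P H t x y * \<phi> (env_act N y H))" for H t x
  define c where "c H = env_equilibrium N \<beta> H \<phi>" for H
  define f where "f H = ennreal \<bar>(\<integral>w. \<phi> (env_process N H (X H) s w) \<partial>M H) - c H\<bar>" for H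
  have \<phi>_le: "\<bar>\<phi> (env_act N y H)\<bar> \<le> 1" for y H
    using \<phi> env_act_in_space by (simp add: test_functions_def)
  have U_evolves: "evolves ?S (metropolis_generator N \<beta> H) (U H)" if "H \<in> space (env_space N)" for H
    using semigroup_evolves[OF finite_configs P(1,2)[OF that]] by (simp add: U_def[abs_def])
  have U_0: "U H 0 x = \<phi> (env_act N x H)" if "H \<in> space (env_space N)" "x \<in> ?S" for H x
  proof -
    have "U H 0 x = (\<Sum>y\<in>?S. if x = y then \<phi> (env_act N y H) else 0)"
      unfolding U_def using P(1)[OF that(1)] that(2)
      by (intro sum.cong) (auto simp: markov_semigroup_def)
    then show ?thesis using that by simp
  qed
  have U_le: "\<bar>U H t x\<bar> \<le> 1" if "H \<in> space (env_space N)" "x \<in> ?S" "0 \<le> t" for H t x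
  proof -
    have nonneg: "0 \<le> P H t x y" if "y \<in> ?S" for y
      using P(1)[OF \<open>H \<in> _\<close>] \<open>x \<in> ?S\<close> \<open>0 \<le> t\<close> that by (simp add: markov_semigroup_def)
    have "\<bar>U H t x\<bar> \<le> (\<Sum>y\<in>?S. \<bar>P H t x y * \<phi> (env_act N y H)\<bar>)"
      unfolding U_def by (rule sum_abs)
    also have "\<dots> \<le> (\<Sum>y\<in>?S. P H t x y)"
      using nonneg \<phi>_le by (intro sum_mono) (simp add: abs_mult mult_right_le_one_le)
    also have "\<dots> = 1"
      using P(1)[OF that(1)] that by (simp add: markov_semigroup_def)
    finally show ?thesis .
  qed
  have c_le: "\<bar>c H\<bar> \<le> 1" for H
    unfolding c_def env_equilibrium_def by (rule abs_gibbs_average_le_1) (rule \<phi>_le)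
  have f_eq: "f H = ennreal \<bar>U H s \<sigma> - c H\<bar>" if "H \<in> space (env_space N)" for H
    using P(3)[OF that, of s "\<lambda>y. \<phi> (env_act N y H)"] s by (simp add: f_def U_def env_process_def)
  have G_space: "H \<in> space (env_space N)" if "H \<in> G" for H
    using sets.sets_into_space[OF G(1)] that by (auto simp: space_rem_measure)
  define e where "e = 2 * \<kappa> + 2 * \<theta> + 2 * l + 186 * real N ^ 4 * exp (\<beta> * (d + b)) / (s * l)"
  have e: "0 \<le> e"
    using \<kappa> \<theta> l s by (simp add: e_def)
  have "(\<integral>\<^sup>+H. f H \<partial>rem_measure N) \<le> ennreal (e + 2 * \<rho>)"
  proof (rule nn_integral_rem_le_average[OF N G _ _ e])
    fix H assume "H \<in> space (rem_measure N)"
    then have H: "H \<in> space (env_space N)" by (simp add: space_rem_measure)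
    have "\<bar>U H s \<sigma> - c H\<bar> \<le> 2"
      using U_le[OF H \<sigma>, of s] c_le[of H] s by linarith
    then have "ennreal \<bar>U H s \<sigma> - c H\<bar> \<le> ennreal 2"
      by (rule ennreal_leI)
    then show "f H \<le> 2" by (simp add: f_eq[OF H])
  next
    fix H assume HG: "H \<in> G"
    then have H: "H \<in> space (env_space N)" by (rule G_space)
    have "(\<Sum>\<tau>\<in>?S. f (env_act N \<tau> H)) = (\<Sum>\<tau>\<in>?S. ennreal \<bar>U H s (cmult N \<sigma> \<tau>) - c H\<bar>)"
    proof (rule sum.cong[OF refl])
      fix \<tau> assume \<tau>: "\<tau> \<in> ?S"
      have "U (env_act N \<tau> H) s \<sigma> = U H s (cmult N \<tau> \<sigma>)"
        by (rule evolves_env_act[where \<phi> = \<phi>, OF \<tau> \<sigma> less_imp_le[OF s] U_evolves[OF H] U_0[OF H]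
              U_evolves[OF env_act_in_space] U_0[OF env_act_in_space]])
      then show "f (env_act N \<tau> H) = ennreal \<bar>U H s (cmult N \<sigma> \<tau>) - c H\<bar>"
        using \<tau> by (simp add: f_eq env_act_in_space c_def env_equilibrium_env_act cmult_commute[of N \<sigma>])
    qed
    also have "\<dots> = (\<Sum>x\<in>?S. ennreal \<bar>U H s x - c H\<bar>)"
      by (rule sum_cmult[OF \<sigma>])
    also have "\<dots> = ennreal (\<Sum>x\<in>?S. \<bar>U H s x - c H\<bar>)"
      by (simp add: sum_ennreal)
    also have "\<dots> \<le> ennreal (2 ^ N * e)"
    proof (rule ennreal_leI)
      have "c H = (\<Sum>y\<in>?S. exp (- \<beta> * H y) * U H 0 y) / (\<Sum>y\<in>?S. exp (- \<beta> * H y))"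
        unfolding c_def env_equilibrium_def gibbs_def sum_divide_distrib
        by (intro sum.cong refl) (simp add: U_0[OF H])
      then show "(\<Sum>x\<in>?S. \<bar>U H s x - c H\<bar>) \<le> 2 ^ N * e"
        using metropolis_relaxation[OF N \<beta> b d \<kappa>(2) l s deg[OF HG] deep[OF HG] \<theta>(2) U_evolves[OF H] U_le[OF H]]
        by (simp add: e_def)
    qed
    also have "\<dots> = 2 ^ N * ennreal e"
      by (simp add: ennreal_mult' ennreal_power[symmetric])
    finally show "(\<Sum>\<tau>\<in>?S. f (env_act N \<tau> H)) \<le> 2 ^ N * ennreal e" .
  qed
  then show ?thesis
    by (simp add: f_def c_def e_def)
qed

lemma elog_le_ln:
  assumes "x \<le> ereal t" "0 < t" shows "elog x \<le> ereal (ln t)"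
  using assms by (cases x) (auto simp: elog_def)

theorem theorem5p5:
  fixes \<epsilon> \<beta> :: real
    and \<sigma> :: "nat \<Rightarrow> config"
    and M :: "nat \<Rightarrow> env \<Rightarrow> 'w measure"
    and X :: "nat \<Rightarrow> env \<Rightarrow> real \<Rightarrow> 'w \<Rightarrow> config"
  assumes "\<epsilon> > 0" and "0 \<le> \<beta>" and "\<beta> \<le> beta_c"
    and "\<And>N. N \<ge> 1 \<Longrightarrow> \<sigma> N \<in> configs N"
    and "\<And>N H. N \<ge> 1 \<Longrightarrow> H \<in> space (env_space N) \<Longrightarrow>
           metropolis_process N \<beta> H (\<sigma> N) (M N H) (X N H)"
  shows "limsup (\<lambda>N. ereal (1 / real N) * elog (T_av N \<beta> (M N) (X N) \<epsilon>)) \<le> ereal (\<beta>\<^sup>2)"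
proof (rule ereal_le_epsilon2)
  fix \<gamma> :: real assume \<gamma>: "0 < \<gamma>"
  \<comment> \<open>\<delta> makes 2 \<beta> \<delta> at most \<gamma> / 2; the other half of
    \<gamma> beats the polynomial in \<open>N\<close>.\<close>
  define \<delta> where "\<delta> = min 1 (\<gamma> / (4 * (\<beta> + 1)))"
  \<comment> \<open>One number serves as \<kappa>, \<theta>, \<open>l\<close> and \<rho>. Their
    contributions add up to \<open>8 * l\<close>, at most \<epsilon> / 2; the cap 1 / 8 ensures
    \<kappa> < 1 / 4 and \<theta> \<le> 1 / 2.\<close>
  define l where "l = min (1 / 8) (\<epsilon> / 16)"
  define T where "T N = exp ((\<beta>\<^sup>2 + \<gamma>) * real N)" for N
  have \<delta>: "0 < \<delta>" "\<delta> \<le> 1"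
    using \<gamma> \<open>0 \<le> \<beta>\<close> by (auto simp: \<delta>_def)
  have l: "0 < l" "l < 1 / 4" "l \<le> 1 / 2" "8 * l \<le> \<epsilon> / 2"
    using \<open>\<epsilon> > 0\<close> by (auto simp: l_def)
  have "\<beta> * \<delta> \<le> \<beta> * (\<gamma> / (4 * (\<beta> + 1)))"
    using \<open>0 \<le> \<beta>\<close> by (intro mult_left_mono) (auto simp: \<delta>_def)
  also have "\<dots> \<le> \<gamma> / 4"
    using \<open>0 \<le> \<beta>\<close> \<gamma> by (simp add: field_simps)
  finally have \<beta>\<delta>: "2 * (\<beta> * \<delta>) \<le> \<gamma> / 2" by simp
  have "(\<lambda>N. 186 * real N ^ 4 / l * exp (- (\<gamma> / 2) * real N)) \<longlonglongrightarrow> 0"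
    using l(1) \<gamma> by real_asymp
  then have "\<forall>\<^sub>F N in sequentially. 186 * real N ^ 4 / l * exp (- (\<gamma> / 2) * real N) < \<epsilon> / 2"
    using \<open>\<epsilon> > 0\<close> by (intro order_tendstoD(2)) auto
  moreover note good_environments[OF assms(2,3) \<delta> \<delta>(1) l(1) l(1) l(1)]
  moreover have "\<forall>\<^sub>F N in sequentially. 0 < N"
    by (rule eventually_gt_at_top)
  ultimately have "\<forall>\<^sub>F N in sequentially.
      ereal (1 / real N) * elog (T_av N \<beta> (M N) (X N) \<epsilon>) \<le> ereal (\<beta>\<^sup>2 + \<gamma>)"
  proof eventually_elim
    case (elim N)
    then have N: "0 < N" "N \<ge> 1" by auto
    obtain G where G: "G \<in> sets (rem_measure N)" "measure (rem_measure N) (space (rem_measure N) - G) \<le> l"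
      and deg: "\<And>H x. H \<in> G \<Longrightarrow> x \<in> configs N \<Longrightarrow> card {i \<in> {1..N}. \<delta> * real N < H (flip N i x)} \<le> l * real N"
      and deep: "\<And>H. H \<in> G \<Longrightarrow> (\<Sum>x\<in>{x\<in>configs N. H x < - ((\<beta> + \<delta>) * real N)}. exp (- \<beta> * H x))
        \<le> l * (\<Sum>x\<in>configs N. exp (- \<beta> * H x))"
      using elim(2) by blast
    have dist_le: "(\<integral>\<^sup>+H. ennreal \<bar>(\<integral>w. \<phi> (env_process N H (X N H) s w) \<partial>M N H) - env_equilibrium N \<beta> H \<phi>\<bar>
        \<partial>rem_measure N) \<le> ennreal \<epsilon>" if s: "T N \<le> s" and \<phi>: "\<phi> \<in> test_functions N" for s \<phi>
    proof -
      have s_pos: "0 < s"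
        using s by (simp add: T_def less_le_trans[OF exp_gt_zero])
      have exp_le: "exp (\<beta> * ((\<beta> + \<delta>) * real N + \<delta> * real N)) / T N \<le> exp (- (\<gamma> / 2) * real N)"
      proof -
        have "\<beta> * ((\<beta> + \<delta>) * real N + \<delta> * real N) - (\<beta>\<^sup>2 + \<gamma>) * real N = (2 * (\<beta> * \<delta>) - \<gamma>) * real N"
          by (simp add: algebra_simps power2_eq_square)
        also have "\<dots> \<le> - (\<gamma> / 2) * real N"
          using \<beta>\<delta> by (intro mult_right_mono) auto
        finally show ?thesis
          unfolding T_def exp_diff[symmetric] by simp
      qed
      define R where "R = 186 * real N ^ 4 * exp (\<beta> * ((\<beta> + \<delta>) * real N + \<delta> * real N)) / (s * l)"
      have "R \<le> 186 * real N ^ 4 * exp (\<beta> * ((\<beta> + \<delta>) * real N + \<delta> * real N)) / (T N * l)"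
        unfolding R_def using s s_pos l by (intro divide_left_mono mult_right_mono) (auto simp: T_def)
      also have "\<dots> = 186 * real N ^ 4 / l * (exp (\<beta> * ((\<beta> + \<delta>) * real N + \<delta> * real N)) / T N)"
        by simp
      also have "\<dots> \<le> 186 * real N ^ 4 / l * exp (- (\<gamma> / 2) * real N)"
        using exp_le l(1) by (intro mult_left_mono) auto
      also have "\<dots> < \<epsilon> / 2"
        by (rule elim(1))
      finally have "R \<le> \<epsilon> / 2"
        by simp
      then have "2 * l + 2 * l + 2 * l + R + 2 * l \<le> \<epsilon>"
        using l(4) by linarith
      moreover have "(\<integral>\<^sup>+H. ennreal \<bar>(\<integral>w. \<phi> (env_process N H (X N H) s w) \<partial>M N H) - env_equilibrium N \<beta> H \<phi>\<bar>
        \<partial>rem_measure N) \<le> ennreal (2 * l + 2 * l + 2 * l + R + 2 * l)"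
        unfolding R_def
        by (rule averaged_distance_le[where \<sigma> = "\<sigma> N", OF N(1) assms(2) _ _ _ l(2) _ l(3) l(1) s_pos assms(4)[OF N(2)] assms(5)[OF N(2)] \<phi> G deg deep])
           (use l \<delta> assms(2) in auto)
      ultimately show ?thesis
        using ennreal_leI order_trans by blast
    qed
    \<comment> \<open>\<open>T N\<close> itself belongs to the set of admissible times, because
      \<open>dist_le\<close> holds for all \<open>s\<close> from \<open>T N\<close> on and all test
      functions.\<close>
    have "T_av N \<beta> (M N) (X N) \<epsilon> \<le> ereal (T N)"
      unfolding T_av_def
      by (rule Inf_lower) (auto simp: T_def intro!: exI[of _ "exp ((\<beta>\<^sup>2 + \<gamma>) * real N)"] SUP_least dist_le[unfolded T_def])
    then have "elog (T_av N \<beta> (M N) (X N) \<epsilon>) \<le> ereal (ln (T N))"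
      by (rule elog_le_ln) (simp add: T_def)
    then have "ereal (1 / real N) * elog (T_av N \<beta> (M N) (X N) \<epsilon>) \<le> ereal (1 / real N) * ereal (ln (T N))"
      by (intro ereal_mult_left_mono) auto
    also have "\<dots> = ereal (\<beta>\<^sup>2 + \<gamma>)"
      using N by (simp add: T_def)
    finally show ?case .
  qed
  then have "limsup (\<lambda>N. ereal (1 / real N) * elog (T_av N \<beta> (M N) (X N) \<epsilon>)) \<le> ereal (\<beta>\<^sup>2 + \<gamma>)"
    by (rule Limsup_bounded)
  then show "limsup (\<lambda>N. ereal (1 / real N) * elog (T_av N \<beta> (M N) (X N) \<epsilon>)) \<le> ereal (\<beta>\<^sup>2) + ereal \<gamma>"
    by simp
qed

end
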